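(* Let $0<\beta<1$, let $L_1(\beta),L_2(\beta)$ be real numbers depending only on $\beta$, and let $f=f(S_F^\alpha(t))$, $t\ge 0$, be an $\alpha$-order fractal differentiable function. Let ${}^{RLC}_0\mathcal{D}_t^\beta f$ be the combined Riemann-Liouville and Caputo fractal derivative $${}^{RLC}_0\mathcal{D}_t^\beta f(S_F^\alpha(t))=\frac{1}{\Gamma_F^\alpha(1-\beta)}\int_{S_F^\alpha(0)}^{S_F^\alpha(t)}\Big(L_1(\beta) f(S_F^\alpha(y))+L_2(\beta) D_F^\alpha f(S_F^\alpha(y))\Big)\big(S_F^\alpha(t)-S_F^\alpha(y)\big)^{-\beta}\,d_F^\alpha y .$$ Then its fractal Laplace transform is $$\mathcal{L}\big[{}^{RLC}_0\mathcal{D}_t^\beta f\big](S_F^\alpha(v))=\left(\frac{L_1(\beta)}{S_F^\alpha(v)}+L_2(\beta)\right)S_F^\alpha(v)^{\beta}\,\mathcal{L}[f](S_F^\alpha(v))-L_2(\beta)\,S_F^\alpha(v)^{\beta-1}f(0)$$ for all $v$ with $S_F^\alpha(v)>0$ such that the fractal Laplace transforms of $f$ and $D_F^\alpha f$ at $S_F^\alpha(v)$ exist, and its fractal Sumudu transform is $$\mathscr{S}\big[{}^{RLC}_0\mathcal{D}_t^\beta f\big](S_F^\alpha(v))=\frac{S_F^\alpha(v)L_1(\beta)+L_2(\beta)}{S_F^\alpha(v)^{\beta}}\,\mathscr{S}[f](S_F^\alpha(v))-\frac{L_2(\beta)}{S_F^\alpha(v)^{\beta}}f(0)$$ for all $v$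 with $S_F^\alpha(v)>0$ such that the fractal Sumudu transforms of $f$ and $D_F^\alpha f$ at $S_F^\alpha(v)$ exist.
   Context: Setting ($F^\alpha$-calculus). Let $0<\alpha\le 1$ and let $F\subset\mathbb{R}$ be a closed fractal set. For an interval $I$ put $\theta(F,I)=1$ if $F\cap I\neq\emptyset$ and $0$ otherwise. The mass function is $$\gamma^\alpha(F,a,b)=\lim_{\delta\to0}\ \inf_{|P|\le\delta}\ \sum_{i}\Gamma(\alpha+1)(x_{i+1}-x_i)^\alpha\,\theta(F,[x_i,x_{i+1}]),$$ the infimum being over finite subdivisions $P=\{a=x_0<\dots<x_n=b\}$ of mesh $|P|\le\delta$. The integral staircase function is $S_F^\alpha(x)=\gamma^\alpha(F,0,x)$ for $x\ge0$ and $S_F^\alpha(x)=-\gamma^\alpha(F,x,0)$ for $x<0$, so $S_F^\alpha(0)=0$. It is assumed finite, continuous and nondecreasing, with $S_F^\alpha(x)\to\infty$ as $x\to\infty$, and $F$ is assumed to be $\alpha$-perfect, i.e. $F$ equals the set of points of change of $S_F^\alpha$ (points in no open interval on which $S_F^\alpha$ is constant). $F^\alpha$-derivative: for $x\in F$, $D_F^\alpha h(x)=\lim_{y\to x,\ y\in F}\dfrac{h(y)-h(x)}{S_F^\alpha(y)-S_F^\alpha(x)}$ when the limit exists, and $D_F^\alpha h(x)=0$ for $x\notin F$. $F^\alpha$-integral: $\int h\,d_F^\alpha t$ over $[a,b]$ is the common value (when they agree) of the supremum of the lower sums $\sum_i m_i\,(S_F^\alpha(x_{i+1})-S_F^\alpha(x_i))$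 and the infimum of the upper sums $\sum_i M_i\,(S_F^\alpha(x_{i+1})-S_F^\alpha(x_i))$ over subdivisions of $[a,b]$, where $m_i,M_i$ are the infimum and supremum of $h$ over $F\cap[x_i,x_{i+1}]$ (taken as $0$ if this set is empty); improper integrals are defined by limits. The integral from $a$ to $b$ is written $\int_{S_F^\alpha(a)}^{S_F^\alpha(b)}h\,d_F^\alpha t$. Functions are written $f(S_F^\alpha(t))$, i.e. as functions of the staircase variable; $f(0)$ is the value at $S_F^\alpha(0)=0$. "$\alpha$-order fractal differentiable" means $f\in C_F^\alpha[0,b]$ for every $b>0$: the $F^\alpha$-derivative $D_F^\alpha f$ exists on $[0,b]$ and is continuous along $F$. $D_F^\alpha f(S_F^\alpha(y))$ denotes the $F^\alpha$-derivative of $y\mapsto f(S_F^\alpha(y))$ at $y$. Fractal gamma function: $\Gamma_F^\alpha(x)=\int_{S_F^\alpha(0)}^{S_F^\alpha(\infty)}e^{-S_F^\alpha(t)}S_F^\alpha(t)^{x-1}\,d_F^\alpha t$ for $x>0$. Fractal Laplace transform: for $\sigma>0$, $\mathcal{L}[f](\sigma)=\int_{S_F^\alpha(0)}^{S_F^\alpha(\infty)}e^{-\sigma S_F^\alpha(t)}f(S_F^\alpha(t))\,d_F^\alpha t$, evaluated at $\sigma=S_F^\alpha(v)$. Fractal Sumudu transform: $\mathscr{S}[f](\sigma)=\frac1\sigma\,\mathcal{L}[f]\!\left(\frac1\sigma\right)=\frac1\sigma\int_{S_F^\alpha(0)}^{S_F^\alpha(\infty)}e^{-S_F^\alpha(t)/\sigma}f(S_F^\alpha(t))\,d_F^\alpha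 t$, evaluated at $\sigma=S_F^\alpha(v)$. Such a transform is said to exist when the integral converges absolutely. *)

theory Defs
  imports "HOL-Analysis.Analysis"
begin

definition subdivision :: "real \<Rightarrow> real \<Rightarrow> nat \<Rightarrow> (nat \<Rightarrow> real) \<Rightarrow> bool" where
  "subdivision a b n x \<longleftrightarrow> x 0 = a \<and> x n = b \<and> (\<forall>i<n. x i < x (Suc i))"

definition hits :: "real set \<Rightarrow> real set \<Rightarrow> real" where
  "hits F I = (if F \<inter> I \<noteq> {} then 1 else 0)"

definition coarse_mass :: "real \<Rightarrow> real set \<Rightarrow> real \<Rightarrow> real \<Rightarrow> real \<Rightarrow> ennreal" where
  "coarse_mass \<alpha> F \<delta> a b =
     Inf {ennreal (\<Sum>i<n. Gamma (\<alpha> + 1) * (x (Suc i) - x i) powr \<alpha> * hits F {x i..x (Suc i)}) | n x.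
            subdivision a b n x \<and> (\<forall>i<n. x (Suc i) - x i \<le> \<delta>)}"

definition mass :: "real \<Rightarrow> real set \<Rightarrow> real \<Rightarrow> real \<Rightarrow> ennreal" where
  "mass \<alpha> F a b = Lim (at_right 0) (\<lambda>\<delta>. coarse_mass \<alpha> F \<delta> a b)"

text \<open>An infinite mass is sent to 0 by \<^const>\<open>enn2real\<close>; the staircase is only meaningful
  under \<open>finite_staircase\<close>.\<close>

definition staircase :: "real \<Rightarrow> real set \<Rightarrow> real \<Rightarrow> real" where
  "staircase \<alpha> F x = (if 0 \<le> x then enn2real (mass \<alpha> F 0 x) else - enn2real (mass \<alpha> F x 0))"

definition finite_staircase :: "real \<Rightarrow> real set \<Rightarrow> bool" where
  "finite_staircase \<alpha> F \<longleftrightarrow> (\<forall>x\<ge>0. mass \<alpha> F 0 x < \<infinity>) \<and> (\<forall>x<0. mass \<alpha> F x 0 < \<infinity>)"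

definition points_of_change :: "(real \<Rightarrow> real) \<Rightarrow> real set" where
  "points_of_change g = {x. \<not> (\<exists>a b. a < x \<and> x < b \<and> g constant_on {a<..<b})}"

definition alpha_perfect :: "real \<Rightarrow> real set \<Rightarrow> bool" where
  "alpha_perfect \<alpha> F \<longleftrightarrow> F = points_of_change (staircase \<alpha> F)"

text \<open>\<open>A\<close> is the domain of \<open>h\<close>: for a function given only for \<open>t \<ge> 0\<close> the limit defining the
  derivative at a point of \<open>F\<close> runs through \<open>F \<inter> {0..}\<close>, so negative arguments play no role.\<close>

definition has_frac_deriv ::
    "real \<Rightarrow> real set \<Rightarrow> real set \<Rightarrow> (real \<Rightarrow> real) \<Rightarrow> real \<Rightarrow> real \<Rightarrow> bool" where
  "has_frac_deriv \<alpha> F A h D x \<longleftrightarrow>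
     ((\<lambda>y. (h y - h x) / (staircase \<alpha> F y - staircase \<alpha> F x)) \<longlongrightarrow> D) (at x within F \<inter> A)"

definition frac_deriv ::
    "real \<Rightarrow> real set \<Rightarrow> real set \<Rightarrow> (real \<Rightarrow> real) \<Rightarrow> real \<Rightarrow> real" where
  "frac_deriv \<alpha> F A h x =
     (if x \<in> F
      then Lim (at x within F \<inter> A) (\<lambda>y. (h y - h x) / (staircase \<alpha> F y - staircase \<alpha> F x))
      else 0)"

text \<open>\<open>f\<close> is a function of the staircase variable, i.e. it stands for \<open>t \<mapsto> f (S t)\<close>, \<open>t \<ge> 0\<close>.\<close>

definition frac_differentiable :: "real \<Rightarrow> real set \<Rightarrow> (real \<Rightarrow> real) \<Rightarrow> bool" where
  "frac_differentiable \<alpha> F f \<longleftrightarrow>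
     (\<forall>b>0. (\<forall>x\<in>F \<inter> {0..b}. \<exists>D. has_frac_deriv \<alpha> F {0..} (\<lambda>t. f (staircase \<alpha> F t)) D x) \<and>
            continuous_on (F \<inter> {0..b}) (frac_deriv \<alpha> F {0..} (\<lambda>t. f (staircase \<alpha> F t))))"

definition frac_lower_sum ::
    "real \<Rightarrow> real set \<Rightarrow> (real \<Rightarrow> real) \<Rightarrow> nat \<Rightarrow> (nat \<Rightarrow> real) \<Rightarrow> real" where
  "frac_lower_sum \<alpha> F h n x =
     (\<Sum>i<n. (if F \<inter> {x i..x (Suc i)} = {} then 0 else Inf (h ` (F \<inter> {x i..x (Suc i)})))
              * (staircase \<alpha> F (x (Suc i)) - staircase \<alpha> F (x i)))"

definition frac_upper_sum ::
    "real \<Rightarrow> real set \<Rightarrow> (real \<Rightarrow> real) \<Rightarrow> nat \<Rightarrow> (nat \<Rightarrow> real) \<Rightarrow> real" where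
  "frac_upper_sum \<alpha> F h n x =
     (\<Sum>i<n. (if F \<inter> {x i..x (Suc i)} = {} then 0 else Sup (h ` (F \<inter> {x i..x (Suc i)})))
              * (staircase \<alpha> F (x (Suc i)) - staircase \<alpha> F (x i)))"

text \<open>The integral over a compact interval is defined for functions bounded on \<open>F \<inter> {a..b}\<close>,
  so the real-valued infima and suprema are genuine.\<close>

definition has_frac_integral ::
    "real \<Rightarrow> real set \<Rightarrow> (real \<Rightarrow> real) \<Rightarrow> real \<Rightarrow> real \<Rightarrow> real \<Rightarrow> bool" where
  "has_frac_integral \<alpha> F h a b I \<longleftrightarrow>
     a \<le> b \<and> bounded (h ` (F \<inter> {a..b})) \<and>
     Sup {frac_lower_sum \<alpha> F h n x | n x. subdivision a b n x} = I \<and>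
     Inf {frac_upper_sum \<alpha> F h n x | n x. subdivision a b n x} = I"

definition frac_integral ::
    "real \<Rightarrow> real set \<Rightarrow> (real \<Rightarrow> real) \<Rightarrow> real \<Rightarrow> real \<Rightarrow> real" where
  "frac_integral \<alpha> F h a b = (THE I. has_frac_integral \<alpha> F h a b I)"

text \<open>The (possibly improper) integral from \<open>p = S a\<close> to \<open>q = S b\<close> is the limit of the integrals
  over compact \<open>{c..d}\<close> as \<open>S c\<close> decreases strictly to \<open>p\<close> and \<open>S d\<close> increases strictly to \<open>q\<close>;
  \<open>q = \<infinity>\<close> is allowed.  When \<open>h\<close> is integrable over \<open>{a..b}\<close> this is the ordinary integral, by
  continuity of the staircase.  The limit must be taken in the staircase variable: if \<open>b\<close> lies in
  or at the right end of a gap of \<open>F\<close>, then \<open>(S b - S y) powr (- \<beta>)\<close> already becomes singular at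
  the left end of that gap, so \<open>d\<close> must not merely stay below \<open>b\<close>.\<close>

definition has_stair_integral ::
    "real \<Rightarrow> real set \<Rightarrow> (real \<Rightarrow> real) \<Rightarrow> ereal \<Rightarrow> ereal \<Rightarrow> real \<Rightarrow> bool" where
  "has_stair_integral \<alpha> F h p q I \<longleftrightarrow>
     p = q \<and> I = 0 \<or>
     p < q \<and>
     (\<forall>c d. c \<le> d \<and> p < ereal (staircase \<alpha> F c) \<and> ereal (staircase \<alpha> F d) < q \<longrightarrow>
        (\<exists>J. has_frac_integral \<alpha> F h c d J)) \<and>
     ((\<lambda>(c, d). frac_integral \<alpha> F h c d) \<longlongrightarrow> I)
       (filtercomap (\<lambda>c. ereal (staircase \<alpha> F c)) (at_right p) \<times>\<^sub>F
        filtercomap (\<lambda>d. ereal (staircase \<alpha> F d)) (at_left q))"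

definition stair_integral ::
    "real \<Rightarrow> real set \<Rightarrow> (real \<Rightarrow> real) \<Rightarrow> ereal \<Rightarrow> ereal \<Rightarrow> real" where
  "stair_integral \<alpha> F h p q = (THE I. has_stair_integral \<alpha> F h p q I)"

definition frac_Gamma :: "real \<Rightarrow> real set \<Rightarrow> real \<Rightarrow> real" where
  "frac_Gamma \<alpha> F x =
     stair_integral \<alpha> F
       (\<lambda>t. exp (- staircase \<alpha> F t) * staircase \<alpha> F t powr (x - 1))
       (staircase \<alpha> F 0) \<infinity>"

text \<open>The transforms take a function \<open>h\<close> of \<open>t\<close>; a function \<open>f\<close> of the staircase variable is
  transformed as \<open>\<lambda>t. f (S t)\<close>.\<close>

definition frac_laplace_exists :: "real \<Rightarrow> real set \<Rightarrow> (real \<Rightarrow> real) \<Rightarrow> real \<Rightarrow> bool" where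
  "frac_laplace_exists \<alpha> F h \<sigma> \<longleftrightarrow>
     (\<exists>I. has_stair_integral \<alpha> F (\<lambda>t. exp (- \<sigma> * staircase \<alpha> F t) * h t)
            (staircase \<alpha> F 0) \<infinity> I) \<and>
     (\<exists>J. has_stair_integral \<alpha> F (\<lambda>t. \<bar>exp (- \<sigma> * staircase \<alpha> F t) * h t\<bar>)
            (staircase \<alpha> F 0) \<infinity> J)"

definition frac_laplace :: "real \<Rightarrow> real set \<Rightarrow> (real \<Rightarrow> real) \<Rightarrow> real \<Rightarrow> real" where
  "frac_laplace \<alpha> F h \<sigma> =
     stair_integral \<alpha> F (\<lambda>t. exp (- \<sigma> * staircase \<alpha> F t) * h t) (staircase \<alpha> F 0) \<infinity>"

definition frac_sumudu_exists :: "real \<Rightarrow> real set \<Rightarrow> (real \<Rightarrow> real) \<Rightarrow> real \<Rightarrow> bool" where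
  "frac_sumudu_exists \<alpha> F h \<sigma> \<longleftrightarrow> frac_laplace_exists \<alpha> F h (1 / \<sigma>)"

definition frac_sumudu :: "real \<Rightarrow> real set \<Rightarrow> (real \<Rightarrow> real) \<Rightarrow> real \<Rightarrow> real" where
  "frac_sumudu \<alpha> F h \<sigma> = 1 / \<sigma> * frac_laplace \<alpha> F h (1 / \<sigma>)"

text \<open>The combined Riemann-Liouville and Caputo derivative of \<open>t \<mapsto> f (S t)\<close>, \<open>t \<ge> 0\<close>.\<close>

definition rlc_deriv ::
    "real \<Rightarrow> real set \<Rightarrow> (real \<Rightarrow> real) \<Rightarrow> (real \<Rightarrow> real) \<Rightarrow> real \<Rightarrow> (real \<Rightarrow> real) \<Rightarrow> real \<Rightarrow> real" where
  "rlc_deriv \<alpha> F L1 L2 \<beta> f t =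
     1 / frac_Gamma \<alpha> F (1 - \<beta>) *
     stair_integral \<alpha> F
       (\<lambda>y. (L1 \<beta> * f (staircase \<alpha> F y)
             + L2 \<beta> * frac_deriv \<alpha> F {0..} (\<lambda>s. f (staircase \<alpha> F s)) y)
            * (staircase \<alpha> F t - staircase \<alpha> F y) powr (- \<beta>))
       (staircase \<alpha> F 0) (staircase \<alpha> F t)"

end

theory Submission
  imports Defs
begin

text \<open>Since \<open>F\<close> is the set of points of change of the staircase \<open>S\<close>, the points of \<open>F\<close> in a cell
  \<open>{x i..x (Suc i)}\<close> are mapped by \<open>S\<close> onto the whole interval between the values of \<open>S\<close> at
  the end points, unless these values agree and the cell does not contribute.  The \<open>F\<close>-integral
  of \<open>h\<close> is therefore the Lebesgue integral of \<open>h \<circ> \<tau>\<close>, where \<open>\<tau>\<close> is the right-continuous right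
  inverse of \<open>S\<close>, and the fractal transforms become classical ones.  The fractal derivative of
  \<open>f \<circ> S\<close> at \<open>\<tau> u\<close> is the right derivative of \<open>f\<close> at \<open>u\<close>; the two end points of a gap of \<open>F\<close>
  may carry different one-sided derivatives, so \<open>f\<close> need not be differentiable, but a continuous
  function is still the integral of its right-continuous right derivative.  This gives
  \<open>\<L>[f'](\<sigma>) = \<sigma> \<L>[f](\<sigma>) - f 0\<close>, and the formula follows from Fubini's theorem for the convolution
  with \<open>r powr (- \<beta>)\<close>, whose Laplace transform is \<open>Gamma (1 - \<beta>) * \<sigma> powr (\<beta> - 1)\<close>.\<close>

subsection \<open>Right derivatives and Lebesgue integrals\<close>

text \<open>For each \<open>e > 0\<close> the set \<open>T\<close> of points whose increment from
  \<open>a\<close> is at most \<open>e * (x - a)\<close> is closed, and a zero right derivative at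
  its supremum pushes that supremum further right unless it is \<open>b\<close>.\<close>

lemma right_derivative_zero_imp_eq:
  fixes Q :: "real \<Rightarrow> real"
  assumes "a \<le> b" and cont: "continuous_on {a..b} Q"
    and deriv: "\<And>x. a \<le> x \<Longrightarrow> x < b \<Longrightarrow> (Q has_real_derivative 0) (at_right x)"
  shows "Q b = Q a"
proof -
  have "\<bar>Q b - Q a\<bar> \<le> e * (b - a)" if "e > 0" for e
  proof -
    define T where "T = {x \<in> {a..b}. \<bar>Q x - Q a\<bar> \<le> e * (x - a)}"
    have "closed T"
      unfolding T_def
      by (intro continuous_on_closed_Collect_le continuous_intros cont)
    moreover have T: "a \<in> T" "bdd_above T" "T \<subseteq> {a..b}"
      using \<open>a \<le> b\<close> by (auto simp: T_def)
    ultimately have s: "Sup T \<in> T"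
      using closed_contains_Sup by blast
    define s where "s = Sup T"
    have "s = b"
    proof (rule ccontr)
      assume "s \<noteq> b"
      with s have "a \<le> s" "s < b" by (auto simp: s_def T_def)
      from deriv[OF this] have "((\<lambda>y. (Q y - Q s) / (y - s)) \<longlongrightarrow> 0) (at_right s)"
        by (simp add: has_field_derivative_iff)
      from tendstoD[OF this \<open>e > 0\<close>] have "eventually (\<lambda>y. \<bar>(Q y - Q s) / (y - s)\<bar> < e) (at_right s)"
        by simp
      moreover have "eventually (\<lambda>y. s < y \<and> y < b) (at_right s)"
        using \<open>s < b\<close> by (auto simp: eventually_at_right_field)
      ultimately obtain y where y: "\<bar>(Q y - Q s) / (y - s)\<bar> < e" "s < y" "y < b"
        using eventually_happens[OF eventually_conj] by (metis (mono_tags, lifting) trivial_limit_at_right_real)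
      then have "\<bar>Q y - Q s\<bar> \<le> e * (y - s)"
        by (simp add: abs_divide field_simps)
      moreover have "\<bar>Q s - Q a\<bar> \<le> e * (s - a)"
        using s by (simp add: s_def T_def)
      ultimately have "\<bar>Q y - Q a\<bar> \<le> e * (y - a)"
        by (simp add: algebra_simps)
      with y \<open>a \<le> s\<close> have "y \<in> T" by (auto simp: T_def)
      then have "y \<le> s" using T by (auto simp: s_def intro: cSup_upper)
      with y show False by simp
    qed
    with s show ?thesis by (simp add: s_def T_def)
  qed
  \<comment> \<open>Adding 1 to \<open>b - a\<close> keeps the denominator positive when
    \<open>a = b\<close>, and the resulting bound is still at most \<open>e\<close>.\<close>
  from this[of "e / (b - a + 1)" for e] have le: "\<bar>Q b - Q a\<bar> \<le> e / (b - a + 1) * (b - a)" if "e > 0" for e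
    using that \<open>a \<le> b\<close> by simp
  have "\<bar>Q b - Q a\<bar> \<le> 0 + e" if "e > 0" for e
  proof -
    have "e / (b - a + 1) * (b - a) \<le> e"
      using that \<open>a \<le> b\<close> by (simp add: field_simps)
    with le[OF that] show ?thesis by simp
  qed
  then have "\<bar>Q b - Q a\<bar> \<le> 0" by (rule field_le_epsilon)
  then show ?thesis by simp
qed

text \<open>Right continuity of \<open>p\<close> gives the indefinite integral of \<open>p\<close>
  the right derivative \<open>p\<close>, so its difference from \<open>P\<close> has right
  derivative 0 and takes equal values at both ends.\<close>

lemma right_derivative_FTC:
  fixes P p :: "real \<Rightarrow> real"
  assumes "a \<le> b" and cont: "continuous_on {a..b} P"
    and deriv: "\<And>x. a \<le> x \<Longrightarrow> x < b \<Longrightarrow> (P has_real_derivative p x) (at_right x)"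
    and right_cont: "\<And>x. a \<le> x \<Longrightarrow> x < b \<Longrightarrow> (p \<longlongrightarrow> p x) (at_right x)"
    and int: "p integrable_on {a..b}"
  shows "integral {a..b} p = P b - P a"
proof -
  define I where "I = (\<lambda>x. integral {a..x} p)"
  have "P b - I b = P a - I a"
  proof (rule right_derivative_zero_imp_eq[OF \<open>a \<le> b\<close>])
    show "continuous_on {a..b} (\<lambda>x. P x - I x)"
      unfolding I_def by (intro continuous_intros cont indefinite_integral_continuous_1 int)
    fix x assume x: "a \<le> x" "x < b"
    \<comment> \<open>Starting the integral at \<open>x\<close> turns right continuity into
      continuity within \<open>{x..b}\<close>; the constant \<open>I x\<close> is added back
      afterwards.\<close>
    have "p integrable_on {x..b}"
      by (rule integrable_subinterval_real[OF int]) (use x in auto)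
    moreover have "continuous (at x within {x..b}) p"
      using right_cont[OF x] x by (simp add: continuous_within at_within_Icc_at_right)
    ultimately have "((\<lambda>u. integral {x..u} p) has_vector_derivative p x) (at x within {x..b})"
      using integral_has_vector_derivative_continuous_at[of p x b x "{}"] x by simp
    then have "((\<lambda>u. I x + integral {x..u} p) has_real_derivative p x) (at x within {x..b})"
      by (auto intro!: derivative_eq_intros simp: has_real_derivative_iff_has_vector_derivative)
    then have "(I has_real_derivative p x) (at x within {x..b})"
    proof (rule has_field_derivative_transform_within[of _ _ _ _ 1])
      fix y assume "y \<in> {x..b}"
      with x show "I x + integral {x..y} p = I y"
        unfolding I_def by (intro Henstock_Kurzweil_Integration.integral_combine integrable_subinterval_real[OF int]) auto
    qed (use x in auto)
    then have "(I has_real_derivative p x) (at_right x)"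
      using x by (simp add: at_within_Icc_at_right)
    from DERIV_diff[OF deriv[OF x] this]
    show "((\<lambda>x. P x - I x) has_real_derivative 0) (at_right x)" by simp
  qed
  then show ?thesis by (simp add: I_def)
qed

text \<open>A limit \<open>l\<close> other than 0 would keep \<open>P\<close> at least
  \<open>\<bar>l\<bar> / 2\<close> in absolute value on a half-line, which has infinite measure.
  This later removes the boundary term at infinity.\<close>

lemma integrable_tendsto_at_top_imp_zero:
  fixes P :: "real \<Rightarrow> real"
  assumes int: "set_integrable lborel {0<..} P" and lim: "(P \<longlongrightarrow> l) at_top"
  shows "l = 0"
proof (rule ccontr)
  assume "l \<noteq> 0"
  then have "eventually (\<lambda>x. \<bar>P x - l\<bar> < \<bar>l\<bar> / 2) at_top"
    using tendstoD[OF lim, of "\<bar>l\<bar> / 2"] by (simp add: dist_real_def)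
  then obtain N where N: "\<And>x. x \<ge> N \<Longrightarrow> \<bar>P x - l\<bar> < \<bar>l\<bar> / 2"
    by (auto simp: eventually_at_top_linorder)
  define N' where "N' = max N 1"
  have "integrable lborel (\<lambda>x. indicator {N'..} x * (\<bar>l\<bar> / 2) :: real)"
  proof (rule Bochner_Integration.integrable_bound)
    show "integrable lborel (\<lambda>x. indicator {0<..} x *\<^sub>R P x)"
      using int by (simp add: set_integrable_def)
    show "AE x in lborel. norm (indicator {N'..} x * (\<bar>l\<bar> / 2) :: real) \<le> norm (indicator {0<..} x *\<^sub>R P x)"
    proof (rule AE_I2)
      fix x :: real
      have "\<bar>l\<bar> / 2 \<le> \<bar>P x\<bar>" if "N' \<le> x"
        using N[of x] that abs_triangle_ineq2[of l "l - P x"] by (simp add: N'_def abs_minus_commute)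
      then show "norm (indicator {N'..} x * (\<bar>l\<bar> / 2) :: real) \<le> norm (indicator {0<..} x *\<^sub>R P x)"
        by (auto simp: indicator_def N'_def)
    qed
  qed auto
  from integrable_mult_left[OF this, of "2 / \<bar>l\<bar>"]
  have "integrable lborel (indicator {N'..} :: real \<Rightarrow> real)"
    using \<open>l \<noteq> 0\<close> by (simp add: mult.assoc)
  then have "emeasure lborel {N'..} < \<infinity>"
    by (simp add: integrable_indicator_iff)
  then obtain n where n: "emeasure lborel {N'..} < of_nat n"
    using ennreal_Ex_less_of_nat by auto
  have "of_nat n = emeasure lborel {N'..N' + real n}" by (simp add: ennreal_of_nat_eq_real_of_nat)
  also have "\<dots> \<le> emeasure lborel {N'..}" by (rule emeasure_mono) auto
  finally show False using n by simp
qed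

text \<open>Carries Euler's integral and the power integral over to \<open>lborel\<close>:
  nonnegativity identifies the gauge integral with the nonnegative Lebesgue integral, whose
  finiteness gives integrability.\<close>

lemma nonneg_has_integral_imp_set_integral:
  fixes f :: "real \<Rightarrow> real"
  assumes "(f has_integral I) A" and nonneg: "\<And>x. x \<in> A \<Longrightarrow> 0 \<le> f x"
    and [measurable]: "f \<in> borel_measurable borel" "A \<in> sets borel"
  shows "set_integrable lborel A f" "(LINT x:A|lborel. f x) = I"
proof -
  have "integral\<^sup>N lborel (\<lambda>x. ennreal (indicator A x * f x)) = ennreal I"
    using nn_integral_has_integral_lebesgue[OF nonneg assms(1)] by simp
  moreover have "0 \<le> I"
    using has_integral_nonneg[OF assms(1) nonneg] .
  moreover have "AE x in lborel. 0 \<le> indicator A x * f x"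
    using nonneg by (auto simp: indicator_def)
  ultimately have "integrable lborel (\<lambda>x. indicator A x * f x) \<and> integral\<^sup>L lborel (\<lambda>x. indicator A x * f x) = I"
    by (subst (asm) nn_integral_eq_integrable) auto
  then show "set_integrable lborel A f" "(LINT x:A|lborel. f x) = I"
    by (auto simp: set_integrable_def set_lebesgue_integral_def)
qed

text \<open>Once \<open>{a..<b}\<close> contains \<open>{l n<..<u n}\<close>, the error is at most
  the integral of \<open>\<bar>k\<bar>\<close> outside that interval, a small tail. The two ends
  move independently, as in the definition of the improper fractal integral.\<close>

lemma tendsto_set_integral_einterval:
  fixes k :: "real \<Rightarrow> real" and p q :: ereal
  assumes "p < q" and int: "set_integrable lborel (einterval p q) k"
  shows "((\<lambda>(a, b). LINT u:{real_of_ereal a..<real_of_ereal b}|lborel. k u) \<longlongrightarrow> (LBINT u=p..q. k u))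
           (at_right p \<times>\<^sub>F at_left q)"
proof (rule tendstoI)
  fix e :: real assume "e > 0"
  obtain l u :: "nat \<Rightarrow> real" where ul: "einterval p q = (\<Union>i. {l i .. u i})"
    "incseq u" "decseq l" "\<And>i. l i < u i" "\<And>i. p < l i" "\<And>i. u i < q"
    "l \<longlonglongrightarrow> p" "u \<longlonglongrightarrow> q"
    by (rule einterval_Icc_approximation[OF \<open>p < q\<close>]) (rule that)
  have int_abs: "set_integrable lborel (einterval p q) (\<lambda>x. \<bar>k x\<bar>)"
    using int by (rule set_integrable_abs)
  have "(\<lambda>i. LBINT x=l i..u i. \<bar>k x\<bar>) \<longlonglongrightarrow> (LBINT x=p..q. \<bar>k x\<bar>)"
    by (rule interval_integral_Icc_approx_integrable[OF \<open>p < q\<close> ul int_abs])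
  from tendstoD[OF this \<open>e > 0\<close>] obtain n where n: "\<bar>(LBINT x=l n..u n. \<bar>k x\<bar>) - (LBINT x=p..q. \<bar>k x\<bar>)\<bar> < e"
    by (auto simp: eventually_sequentially dist_real_def)
  let ?E = "einterval p q"
  have "dist (LINT u:{real_of_ereal a..<real_of_ereal b}|lborel. k u) (LBINT u=p..q. k u) < e"
    if a: "p < a" "a < l n" and b: "u n < b" "b < q" for a b :: ereal
  proof -
    obtain a' where a': "a = ereal a'" using a ul(5)[of n] by (cases a) auto
    obtain b' where b': "b = ereal b'" using b ul(6)[of n] by (cases b) auto
    let ?B = "{a'..<b'}" and ?L = "{l n<..<u n}"
    have sub: "?L \<subseteq> ?B" "?B \<subseteq> ?E"
    proof -
      show "?L \<subseteq> ?B" using a b a' b' by auto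
      show "?B \<subseteq> ?E"
      proof
        fix x assume "x \<in> ?B"
        then have "ereal a' \<le> ereal x" "ereal x < ereal b'" by auto
        with a b a' b' show "x \<in> ?E"
          unfolding einterval_iff by (metis less_le_trans less_trans)
      qed
    qed
    have i1: "set_integrable lborel A k" "set_integrable lborel A (\<lambda>x. \<bar>k x\<bar>)"
      if "A \<in> sets borel" "A \<subseteq> ?E" for A
      using that int int_abs by (auto intro: set_integrable_subset)
    have "(LINT u:?E|lborel. k u) = (LINT u:?B \<union> (?E - ?B)|lborel. k u)"
      using sub by (simp add: Un_absorb1)
    also have "\<dots> = (LINT u:?B|lborel. k u) + (LINT u:?E - ?B|lborel. k u)"
      by (rule set_integral_Un) (use sub i1 in auto)
    finally have 1: "(LINT u:?E|lborel. k u) - (LINT u:?B|lborel. k u) = (LINT u:?E - ?B|lborel. k u)" by simp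
    have "(LINT u:?E|lborel. \<bar>k u\<bar>) = (LINT u:?L \<union> (?E - ?L)|lborel. \<bar>k u\<bar>)"
      using sub by (simp add: Un_absorb1 subset_trans[OF sub])
    also have "\<dots> = (LINT u:?L|lborel. \<bar>k u\<bar>) + (LINT u:?E - ?L|lborel. \<bar>k u\<bar>)"
      by (rule set_integral_Un) (use sub i1 in auto)
    finally have 2: "(LINT u:?E|lborel. \<bar>k u\<bar>) - (LINT u:?L|lborel. \<bar>k u\<bar>) = (LINT u:?E - ?L|lborel. \<bar>k u\<bar>)" by simp
    have "\<bar>LINT u:?E - ?B|lborel. k u\<bar> \<le> (LINT u:?E - ?B|lborel. \<bar>k u\<bar>)"
      using set_integral_norm_bound[OF i1(1)[of "?E - ?B"]] by simp
    also have "\<dots> \<le> (LINT u:?E - ?L|lborel. \<bar>k u\<bar>)"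
      unfolding set_lebesgue_integral_def
    proof (rule integral_mono)
      show "integrable lborel (\<lambda>x. indicator (?E - ?B) x *\<^sub>R \<bar>k x\<bar>)"
        "integrable lborel (\<lambda>x. indicator (?E - ?L) x *\<^sub>R \<bar>k x\<bar>)"
        unfolding set_integrable_def[symmetric] by (auto intro!: i1)
      show "indicator (?E - ?B) x *\<^sub>R \<bar>k x\<bar> \<le> indicator (?E - ?L) x *\<^sub>R \<bar>k x\<bar>" for x
        using sub(1) by (intro scaleR_right_mono) (auto simp: indicator_def)
    qed
    also have "\<dots> < e"
      using n 2 ul(4)[of n] \<open>p < q\<close> by (simp add: interval_lebesgue_integral_def less_imp_le)
    finally show ?thesis
      using 1 \<open>p < q\<close> by (simp add: a' b' dist_real_def interval_lebesgue_integral_def less_imp_le abs_minus_commute)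
  qed
  then show "eventually (\<lambda>x. dist (case x of (a, b) \<Rightarrow> LINT u:{real_of_ereal a..<real_of_ereal b}|lborel. k u) (LBINT u=p..q. k u) < e)
      (at_right p \<times>\<^sub>F at_left q)"
    unfolding eventually_prod_filter
  proof (intro exI conjI allI impI)
    show "eventually (\<lambda>a. p < a \<and> a < l n) (at_right p)"
      unfolding eventually_at_right[OF ul(5)[of n]] using ul(5)[of n] by blast
    show "eventually (\<lambda>b. u n < b \<and> b < q) (at_left q)"
      unfolding eventually_at_left[OF ul(6)[of n]] using ul(6)[of n] by blast
  qed auto
qed

subsection \<open>Convolution with a power kernel\<close>

text \<open>Translation invariance makes the integral of \<open>\<bar>M (q - s)\<bar>\<close> over
  \<open>q\<close> independent of \<open>s\<close>, so the integrand is integrable on the plane and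
  Fubini splits the double integral.\<close>

lemma convolution_lborel:
  fixes K M :: "real \<Rightarrow> real"
  assumes K: "integrable lborel K" and M: "integrable lborel M"
  shows "integrable lborel (\<lambda>q. LINT s|lborel. K s * M (q - s))"
    and "(LINT q|lborel. LINT s|lborel. K s * M (q - s)) = (LINT s|lborel. K s) * (LINT s|lborel. M s)"
proof -
  have [measurable]: "K \<in> borel_measurable borel" "M \<in> borel_measurable borel"
    using K M by auto
  have shift: "integrable lborel (\<lambda>q. M (q - s))" "(LINT q|lborel. M (q - s)) = (LINT q|lborel. M q)"
    "(LINT q|lborel. \<bar>M (q - s)\<bar>) = (LINT q|lborel. \<bar>M q\<bar>)" for s
    using lborel_integrable_real_affine[OF M, of 1 "-s"] lborel_integral_real_affine[of 1 M "-s"]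
      lborel_integral_real_affine[of 1 "\<lambda>q. \<bar>M q\<bar>" "-s"] by simp_all
  have int: "integrable (lborel \<Otimes>\<^sub>M lborel) (\<lambda>(s, q). K s * M (q - s))"
  proof (rule lborel_pair.Fubini_integrable)
    show "integrable lborel (\<lambda>x. LINT y|lborel. norm (case (x, y) of (s, q) \<Rightarrow> K s * M (q - s)))"
      using K by (simp add: abs_mult shift)
  qed (use shift in auto)
  from lborel_pair.integrable_snd[OF this]
  show "integrable lborel (\<lambda>q. LINT s|lborel. K s * M (q - s))" by simp
  from lborel_pair.Fubini_integral[OF int]
  show "(LINT q|lborel. LINT s|lborel. K s * M (q - s)) = (LINT s|lborel. K s) * (LINT s|lborel. M s)"
    by (simp add: shift)
qed

text \<open>Extended by zero to \<open>r \<le> 0\<close>, so that integrating against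
  \<open>power_kernel \<beta> (q - s)\<close> over the whole line only sees
  \<open>s < q\<close>.\<close>

definition power_kernel :: "real \<Rightarrow> real \<Rightarrow> real" where
  "power_kernel \<beta> r = indicator {0<..} r * r powr (- \<beta>)"

lemma power_kernel_measurable [measurable]: "power_kernel \<beta> \<in> borel_measurable borel"
  unfolding power_kernel_def by measurable

lemma power_kernel_nonneg: "0 \<le> power_kernel \<beta> r"
  by (simp add: power_kernel_def)

text \<open>Euler's integral for \<open>Gamma (1 - \<beta>)\<close> after substituting
  \<open>\<sigma> * r\<close> for \<open>r\<close>.\<close>

lemma Laplace_power_kernel:
  assumes "0 < \<sigma>" "\<beta> < 1"
  shows "integrable lborel (\<lambda>r. exp (- \<sigma> * r) * power_kernel \<beta> r)"
    and "(LINT r|lborel. exp (- \<sigma> * r) * power_kernel \<beta> r) = Gamma (1 - \<beta>) * \<sigma> powr (\<beta> - 1)"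
proof -
  let ?m = "\<lambda>r. exp (- r) * power_kernel \<beta> r"
  have "((\<lambda>t. t powr (1 - \<beta> - 1) / exp t) has_integral Gamma (1 - \<beta>)) {0..}"
    by (rule Gamma_integral_real) (use assms in auto)
  then have "((\<lambda>t. exp (-t) * power_kernel \<beta> t) has_integral Gamma (1 - \<beta>)) {0..}"
    by (rule has_integral_spike[rotated 2, of _ _ _ "{0}"]) (auto simp: power_kernel_def exp_minus field_simps)
  note * = nonneg_has_integral_imp_set_integral[OF this]
  have eq: "indicator {0..} r * ?m r = ?m r" for r
    by (auto simp: indicator_def power_kernel_def)
  have 1: "integrable lborel ?m" "(LINT r|lborel. ?m r) = Gamma (1 - \<beta>)"
    using * by (simp_all add: power_kernel_nonneg set_integrable_def set_lebesgue_integral_def eq)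
  \<comment> \<open>The kernel at \<open>\<sigma> * r\<close> carries the factor
    \<open>\<sigma> powr (- \<beta>)\<close>, which \<open>\<sigma> powr \<beta>\<close> cancels; a
    further factor \<open>1 / \<sigma>\<close> comes from the change of variables.\<close>
  have scale: "exp (- \<sigma> * r) * power_kernel \<beta> r = \<sigma> powr \<beta> * ?m (0 + \<sigma> * r)" for r
    using assms by (auto simp: power_kernel_def indicator_def powr_mult powr_minus zero_less_mult_iff)
  show "integrable lborel (\<lambda>r. exp (- \<sigma> * r) * power_kernel \<beta> r)"
    unfolding scale using lborel_integrable_real_affine[OF 1(1), of \<sigma> 0] assms
    by (intro integrable_mult_right) auto
  have "\<sigma> * (LINT r|lborel. ?m (0 + \<sigma> * r)) = Gamma (1 - \<beta>)"
    using lborel_integral_real_affine[of \<sigma> ?m 0] 1(2) assms by simp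
  then have "(LINT r|lborel. ?m (0 + \<sigma> * r)) = Gamma (1 - \<beta>) / \<sigma>"
    using assms by (simp add: field_simps)
  then show "(LINT r|lborel. exp (- \<sigma> * r) * power_kernel \<beta> r) = Gamma (1 - \<beta>) * \<sigma> powr (\<beta> - 1)"
    unfolding scale integral_mult_right_zero using assms by (simp add: powr_diff)
qed

text \<open>The reflection of \<open>s\<close> to \<open>q - s\<close> leads to the elementary
  integral of \<open>r powr (- \<beta>)\<close> over \<open>{0..q-a}\<close>, which converges at 0
  because \<open>\<beta> < 1\<close>.\<close>

lemma power_kernel_integral:
  assumes "\<beta> < 1" "a \<le> q"
  shows "integrable lborel (\<lambda>s. indicator {a..} s * power_kernel \<beta> (q - s))"
    and "(LINT s|lborel. indicator {a..} s * power_kernel \<beta> (q - s)) = (q - a) powr (1 - \<beta>) / (1 - \<beta>)"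
proof -
  let ?m = "\<lambda>r. indicator {0..q-a} r * power_kernel \<beta> r :: real"
  have "((\<lambda>x. x powr (-\<beta>)) has_integral ((q - a) powr (- \<beta> + 1) / (- \<beta> + 1))) {0..q-a}"
    by (rule has_integral_powr_from_0) (use assms in auto)
  then have "((\<lambda>x. power_kernel \<beta> x) has_integral ((q - a) powr (- \<beta> + 1) / (- \<beta> + 1))) {0..q-a}"
    by (rule has_integral_spike[rotated 2, of _ _ _ "{0}"]) (auto simp: power_kernel_def)
  note * = nonneg_has_integral_imp_set_integral[OF this]
  have 1: "integrable lborel ?m" "(LINT r|lborel. ?m r) = (q - a) powr (1 - \<beta>) / (1 - \<beta>)"
    using * by (simp_all add: power_kernel_nonneg set_integrable_def set_lebesgue_integral_def)
  have eq: "?m (q + (-1) * s) = indicator {a..} s * power_kernel \<beta> (q - s)" for s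
    by (auto simp: indicator_def power_kernel_def)
  show "integrable lborel (\<lambda>s. indicator {a..} s * power_kernel \<beta> (q - s))"
    using lborel_integrable_real_affine[OF 1(1), of "-1" q] by (simp only: eq)
  show "(LINT s|lborel. indicator {a..} s * power_kernel \<beta> (q - s)) = (q - a) powr (1 - \<beta>) / (1 - \<beta>)"
    using lborel_integral_real_affine[of "-1" ?m q] 1(2) by (simp only: eq) simp
qed

text \<open>\<^term>\<open>W\<close> is merely locally bounded, so continuity has to come from the kernel: the bound
  below is Hoelder continuity with exponent \<^term>\<open>1 - \<beta>\<close>.\<close>

lemma fractional_integral_Hoelder:
  fixes W :: "real \<Rightarrow> real"
  assumes "0 < \<beta>" "\<beta> < 1" "0 < q" "q \<le> q'"
    and [measurable]: "W \<in> borel_measurable borel"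
    and zero: "\<And>s. s \<le> 0 \<Longrightarrow> W s = 0"
    and bound: "\<And>s. s \<le> q' \<Longrightarrow> \<bar>W s\<bar> \<le> C"
  shows "integrable lborel (\<lambda>s. W s * power_kernel \<beta> (q - s))" (is ?int)
    and "\<bar>(LINT s|lborel. W s * power_kernel \<beta> (q' - s)) - (LINT s|lborel. W s * power_kernel \<beta> (q - s))\<bar>
           \<le> 2 * C * (q' - q) powr (1 - \<beta>) / (1 - \<beta>)" (is ?diff)
proof -
  have int: "integrable lborel (\<lambda>s. W s * power_kernel \<beta> (r - s))" if r: "0 < r" "r \<le> q'" for r
  proof (rule Bochner_Integration.integrable_bound)
    show "integrable lborel (\<lambda>s. C * (indicator {0..} s * power_kernel \<beta> (r - s)))"
      using assms r by (intro integrable_mult_right power_kernel_integral) auto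
    show "AE s in lborel. norm (W s * power_kernel \<beta> (r - s)) \<le> norm (C * (indicator {0..} s * power_kernel \<beta> (r - s)))"
    proof (rule AE_I2)
      fix s
      show "norm (W s * power_kernel \<beta> (r - s)) \<le> norm (C * (indicator {0..} s * power_kernel \<beta> (r - s)))"
      proof (cases "0 < s \<and> s < r")
        case True
        with bound[of s] r have "\<bar>W s\<bar> \<le> \<bar>C\<bar>" by linarith
        with True show ?thesis
          by (auto simp: abs_mult intro!: mult_right_mono)
      next
        case False
        then show ?thesis using zero[of s] by (auto simp: power_kernel_def)
      qed
    qed
  qed measurable
  then show ?int using assms by simp
  let ?k = "\<lambda>a r s. indicator {a..} s * power_kernel \<beta> (r - s) :: real"
  have "\<bar>(LINT s|lborel. W s * power_kernel \<beta> (q' - s)) - (LINT s|lborel. W s * power_kernel \<beta> (q - s))\<bar>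
     = norm (LINT s|lborel. W s * power_kernel \<beta> (q' - s) - W s * power_kernel \<beta> (q - s))"
    using int assms by simp
  \<comment> \<open>The bracket is the absolute difference of the two kernels: for
    \<open>s < q\<close> the kernel at \<open>q\<close> is the larger one, and for
    \<open>q \<le> s < q'\<close> only the kernel at \<open>q'\<close> is left, which is subtracted
    once and added twice.\<close>
  also have "\<dots> \<le> (LINT s|lborel. C * (?k 0 q s - ?k 0 q' s + 2 * ?k q q' s))"
  proof (rule Bochner_Integration.integral_norm_bound_integral)
    show "integrable lborel (\<lambda>s. C * (?k 0 q s - ?k 0 q' s + 2 * ?k q q' s))"
      using assms by (intro integrable_mult_right Bochner_Integration.integrable_add Bochner_Integration.integrable_diff power_kernel_integral) auto
    show "integrable lborel (\<lambda>s. W s * power_kernel \<beta> (q' - s) - W s * power_kernel \<beta> (q - s))"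
      using int assms by auto
    fix s
    have le: "power_kernel \<beta> (q' - s) \<le> power_kernel \<beta> (q - s)" if "s < q"
      using that assms by (auto simp: power_kernel_def intro!: powr_mono2')
    have "\<bar>W s * power_kernel \<beta> (q' - s) - W s * power_kernel \<beta> (q - s)\<bar>
        = \<bar>W s\<bar> * \<bar>power_kernel \<beta> (q' - s) - power_kernel \<beta> (q - s)\<bar>"
      unfolding right_diff_distrib[symmetric] by (rule abs_mult)
    also have "\<dots> \<le> C * (?k 0 q s - ?k 0 q' s + 2 * ?k q q' s)"
    proof (cases "0 \<le> s \<and> s < q'")
      case True
      show ?thesis
      proof (rule mult_mono)
        show "\<bar>power_kernel \<beta> (q' - s) - power_kernel \<beta> (q - s)\<bar> \<le> ?k 0 q s - ?k 0 q' s + 2 * ?k q q' s"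
        proof (cases "s < q")
          case True
          with le[OF this] \<open>0 \<le> s \<and> s < q'\<close> show ?thesis by simp
        next
          case False
          then have "power_kernel \<beta> (q - s) = 0" by (simp add: power_kernel_def)
          with False \<open>0 \<le> s \<and> s < q'\<close> show ?thesis
            using power_kernel_nonneg[of \<beta> "q' - s"] by simp
        qed
        show "\<bar>W s\<bar> \<le> C" using bound[of s] True by simp
        then show "0 \<le> C" by linarith
      qed simp
    next
      case False
      then consider "s < 0" | "0 \<le> s" "q' \<le> s" by linarith
      then show ?thesis
      proof cases
        case 1
        then show ?thesis using zero[of s] assms by simp
      next
        case 2
        with assms have "power_kernel \<beta> (q' - s) = 0" "power_kernel \<beta> (q - s) = 0"
          by (auto simp: power_kernel_def)
        then show ?thesis by simp
      qed
    qed
    finally show "norm (W s * power_kernel \<beta> (q' - s) - W s * power_kernel \<beta> (q - s)) \<le> C * (?k 0 q s - ?k 0 q' s + 2 * ?k q q' s)"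
      by simp
  qed
  also have "\<dots> = C * (q powr (1 - \<beta>) / (1 - \<beta>) - q' powr (1 - \<beta>) / (1 - \<beta>) + 2 * ((q' - q) powr (1 - \<beta>) / (1 - \<beta>)))"
  proof -
    have k: "has_bochner_integral lborel (?k a r) ((r - a) powr (1 - \<beta>) / (1 - \<beta>))" if "a \<le> r" for a r
      unfolding has_bochner_integral_iff using power_kernel_integral[OF \<open>\<beta> < 1\<close> that] by blast
    have "has_bochner_integral lborel (\<lambda>s. C * (?k 0 q s - ?k 0 q' s + 2 * ?k q q' s))
      (C * ((q - 0) powr (1 - \<beta>) / (1 - \<beta>) - (q' - 0) powr (1 - \<beta>) / (1 - \<beta>) + 2 * ((q' - q) powr (1 - \<beta>) / (1 - \<beta>))))"
      using assms by (intro has_bochner_integral_mult_right has_bochner_integral_add has_bochner_integral_diff k) auto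
    then show ?thesis by (simp only: has_bochner_integral_iff diff_zero)
  qed
  \<comment> \<open>The first two terms have a nonpositive difference, since
    \<open>q \<le> q'\<close> and the exponent \<open>1 - \<beta>\<close> is positive.\<close>
  also have "\<dots> \<le> C * (2 * ((q' - q) powr (1 - \<beta>) / (1 - \<beta>)))"
  proof (rule mult_left_mono)
    show "0 \<le> C" using bound[of 0] zero[of 0] assms by simp
    have "q powr (1 - \<beta>) / (1 - \<beta>) \<le> q' powr (1 - \<beta>) / (1 - \<beta>)"
      using assms by (intro divide_right_mono powr_mono2) auto
    then show "q powr (1 - \<beta>) / (1 - \<beta>) - q' powr (1 - \<beta>) / (1 - \<beta>) + 2 * ((q' - q) powr (1 - \<beta>) / (1 - \<beta>))
       \<le> 2 * ((q' - q) powr (1 - \<beta>) / (1 - \<beta>))" by simp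
  qed
  finally show ?diff by (simp add: mult_ac)
qed

text \<open>Hoelder bounds on both sides of \<open>q\<close> force convergence at \<open>q\<close>.
  This continuity later allows the combined derivative itself to be integrated along
  \<open>F\<close>.\<close>

lemma fractional_integral_continuous:
  fixes W :: "real \<Rightarrow> real"
  assumes "0 < \<beta>" "\<beta> < 1"
    and meas: "W \<in> borel_measurable borel"
    and zero: "\<And>s. s \<le> 0 \<Longrightarrow> W s = 0"
    and bound: "\<And>b. \<exists>C. \<forall>s\<le>b. \<bar>W s\<bar> \<le> C"
  shows "continuous_on {0<..} (\<lambda>q. LINT s|lborel. W s * power_kernel \<beta> (q - s))"
proof -
  define g where "g = (\<lambda>q. LINT s|lborel. W s * power_kernel \<beta> (q - s))"
  have "isCont g q" if "0 < q" for q
  proof -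
    \<comment> \<open>A bound up to \<open>q + 1\<close> serves all nearby \<open>x\<close> on
      either side of \<open>q\<close>, so one constant suffices.\<close>
    obtain C where C: "\<And>s. s \<le> q + 1 \<Longrightarrow> \<bar>W s\<bar> \<le> C"
      using bound by blast
    have "\<bar>g x - g q\<bar> \<le> 2 * C * \<bar>x - q\<bar> powr (1 - \<beta>) / (1 - \<beta>)" if x: "0 < x" "x < q + 1" for x
    proof (cases "q \<le> x")
      case True
      with fractional_integral_Hoelder(2)[OF assms(1,2) \<open>0 < q\<close> True meas zero, of C] C x
      show ?thesis by (simp add: g_def)
    next
      case False
      with fractional_integral_Hoelder(2)[OF assms(1,2) \<open>0 < x\<close> _ meas zero, of q C] C x
      show ?thesis by (simp add: g_def abs_minus_commute)
    qed
    moreover have "eventually (\<lambda>x. 0 < x \<and> x < q + 1) (at q)"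
      using eventually_at_in_open'[of "{0<..<q+1}" q] \<open>0 < q\<close> by simp
    ultimately have "eventually (\<lambda>x. norm (g x - g q) \<le> 2 * C * \<bar>x - q\<bar> powr (1 - \<beta>) / (1 - \<beta>)) (at q)"
      by (auto elim!: eventually_mono)
    moreover have "((\<lambda>x. 2 * C * \<bar>x - q\<bar> powr (1 - \<beta>) / (1 - \<beta>)) \<longlongrightarrow> 0) (at q)"
    proof -
      have "((\<lambda>x. \<bar>x - q\<bar>) \<longlongrightarrow> 0) (at q)"
        by (rule tendsto_rabs_zero) (rule LIM_zero[OF tendsto_ident_at])
      then have "((\<lambda>x. \<bar>x - q\<bar> powr (1 - \<beta>)) \<longlongrightarrow> 0) (at q)"
        using \<open>\<beta> < 1\<close> by (intro tendsto_zero_powrI[where b = "1 - \<beta>"]) auto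
      from tendsto_divide_zero[OF tendsto_mult_right_zero[OF this]] show ?thesis .
    qed
    ultimately have "((\<lambda>x. g x - g q) \<longlongrightarrow> 0) (at q)"
      by (rule Lim_null_comparison)
    then show ?thesis
      unfolding isCont_def by (rule LIM_zero_cancel)
  qed
  then show ?thesis
    unfolding g_def by (intro continuous_at_imp_continuous_on) auto
qed

lemma einterval_0_infty [simp]: "einterval 0 \<infinity> = {0<..}"
  by (auto simp: einterval_iff)

subsection \<open>The staircase and its right inverse\<close>

lemma staircase_0 [simp]: "staircase \<alpha> F 0 = 0"
proof -
  have "coarse_mass \<alpha> F \<delta> 0 0 = 0" for \<delta>
  proof -
    \<comment> \<open>With \<open>n = 0\<close> the subdivision is a single point and the sum over
      its cells is empty.\<close>
    have "\<exists>x. subdivision 0 0 0 x" by (auto simp: subdivision_def)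
    then have "coarse_mass \<alpha> F \<delta> 0 0 \<le> 0"
      unfolding coarse_mass_def by (intro Inf_lower) (auto intro!: exI[of _ "0::nat"])
    then show ?thesis by simp
  qed
  then have "mass \<alpha> F 0 0 = 0"
    unfolding mass_def by (simp add: tendsto_Lim)
  then show ?thesis by (simp add: staircase_def)
qed

section \<open>Subdivisions and Darboux sums\<close>

lemma subdivision_mono:
  assumes "subdivision c d n x" "i \<le> j" "j \<le> n"
  shows "x i \<le> x j"
  using assms(2,3)
proof (induction j rule: dec_induct)
  case (step j)
  then show ?case using assms(1) by (auto simp: subdivision_def Suc_le_eq intro: order.trans less_imp_le)
qed simp

lemma subdivision_bounds:
  assumes "subdivision c d n x" "i \<le> n"
  shows "c \<le> x i" "x i \<le> d"
  using subdivision_mono[OF assms(1), of 0 i] subdivision_mono[OF assms(1), of i n] assms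
  by (auto simp: subdivision_def)

lemma subdivision_fine_exists:
  assumes "c \<le> d" "0 < \<delta>"
  shows "\<exists>n x. subdivision c d n x \<and> (\<forall>i<n. x (Suc i) - x i < \<delta>)"
proof (cases "c = d")
  case True
  then show ?thesis
    by (intro exI[of _ 0] exI[of _ "\<lambda>_. c"]) (simp add: subdivision_def)
next
  case False
  with assms have "c < d" by simp
  obtain n :: nat where n: "(d - c) / \<delta> < real n"
    using reals_Archimedean2 by blast
  with \<open>c < d\<close> \<open>0 < \<delta>\<close> have "0 < n"
    by (metis divide_pos_pos diff_gt_0_iff_gt less_trans of_nat_0_less_iff)
  define x where "x = (\<lambda>i. c + real i * ((d - c) / real n))"
  have "x (Suc i) - x i = (d - c) / real n" for i
    by (simp add: x_def algebra_simps add_divide_distrib diff_divide_distrib)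
  moreover have "0 < (d - c) / real n" "(d - c) / real n < \<delta>"
    using n \<open>0 < n\<close> \<open>c < d\<close> \<open>0 < \<delta>\<close> by (auto simp: field_simps)
  moreover have "x 0 = c" "x n = d" using \<open>0 < n\<close> by (auto simp: x_def)
  ultimately show ?thesis
    by (intro exI[of _ n] exI[of _ x]) (auto simp: subdivision_def, smt (verit))
qed

text \<open>Lets the lower estimate for upper sums follow from the upper estimate for lower sums,
  applied to the negated function.\<close>

lemma frac_upper_sum_uminus:
  "frac_upper_sum \<alpha> F h n x = - frac_lower_sum \<alpha> F (\<lambda>t. - h t) n x"
proof -
  have "Sup (h ` X) = - Inf ((\<lambda>t. - h t) ` X)" for X
    by (simp add: Inf_real_def image_image)
  then show ?thesis
    unfolding frac_upper_sum_def frac_lower_sum_def sum_negf[symmetric]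
    by (intro sum.cong) auto
qed

section \<open>The right inverse of the staircase\<close>

locale frac_staircase =
  fixes \<alpha> :: real and F :: "real set"
  assumes closed_F: "closed F"
    and cont_S: "continuous_on UNIV (staircase \<alpha> F)"
    and mono_S: "mono (staircase \<alpha> F)"
    and S_at_top: "filterlim (staircase \<alpha> F) at_top at_top"
    and perfect: "alpha_perfect \<alpha> F"
begin

abbreviation S :: "real \<Rightarrow> real" where "S \<equiv> staircase \<alpha> F"

text \<open>\<open>\<tau> u\<close> is the right end of the level set \<open>{t. S t = u}\<close>; it lies in \<open>F\<close>, whereas interior
  points of a level set do not.\<close>

definition \<tau> :: "real \<Rightarrow> real" where "\<tau> u = Sup {t. S t \<le> max 0 u}"

text \<open>The sublevel set \<open>{t. S t \<le> u}\<close> is nonempty by the intermediate value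
  theorem from \<open>S 0 = 0\<close>, closed by continuity, and bounded above because the staircase
  tends to infinity; so its supremum belongs to it and carries the value \<open>u\<close>. The
  equivalence is a Galois connection that converts inequalities between the two variables.\<close>

lemma
  assumes "0 \<le> u"
  shows S_le_iff_le_\<tau>: "S t \<le> u \<longleftrightarrow> t \<le> \<tau> u" and S_\<tau>: "S (\<tau> u) = u"
proof -
  define T where "T = {t. S t \<le> u}"
  obtain N where N: "\<And>t. t \<ge> N \<Longrightarrow> S t > u"
    using S_at_top by (auto simp: filterlim_at_top_dense eventually_at_top_linorder)
  have T: "\<tau> u = Sup T" using assms by (simp add: \<tau>_def T_def max_def)
  have bdd: "bdd_above T"
    by (intro bdd_aboveI[of _ N]) (metis N T_def leD linorder_linear mem_Collect_eq)
  have "\<exists>t\<ge>0. t \<le> max 0 N \<and> S t = u"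
    by (rule IVT') (use assms N[of "max 0 N"] cont_S in \<open>auto intro: continuous_on_subset less_imp_le\<close>)
  then obtain t0 where t0: "S t0 = u" by blast
  then have "t0 \<in> T" by (simp add: T_def)
  have "closed T" unfolding T_def by (intro closed_Collect_le cont_S continuous_intros)
  then have "Sup T \<in> T" using \<open>t0 \<in> T\<close> bdd closed_contains_Sup by blast
  moreover have "u \<le> S (Sup T)"
    using t0 monoD[OF mono_S cSup_upper[OF \<open>t0 \<in> T\<close> bdd]] by simp
  ultimately show *: "S (\<tau> u) = u" by (simp add: T T_def)
  show "S t \<le> u \<longleftrightarrow> t \<le> \<tau> u"
    using cSup_upper[OF _ bdd, of t] monoD[OF mono_S, of t "\<tau> u"] * T by (auto simp: T_def)
qed

lemma \<tau>_nonneg: "0 \<le> u \<Longrightarrow> 0 \<le> \<tau> u"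
  using S_le_iff_le_\<tau>[of u 0] by simp

lemma \<tau>_max: "\<tau> u = \<tau> (max 0 u)"
  by (simp add: \<tau>_def)

lemma \<tau>_less_iff: "0 \<le> u \<Longrightarrow> \<tau> u < t \<longleftrightarrow> u < S t"
  using S_le_iff_le_\<tau>[of u t] by (simp add: not_le[symmetric])

lemma \<tau>_strict_mono: "0 \<le> u \<Longrightarrow> u < v \<Longrightarrow> \<tau> u < \<tau> v"
  by (simp add: \<tau>_less_iff S_\<tau>)

text \<open>The truncation \<open>max 0 u\<close> in \<open>\<tau>\<close> pays off here: for
  negative \<open>u\<close> the sublevel set may be empty, whereas the truncated version is monotone
  on the whole line.\<close>

lemma \<tau>_measurable [measurable]: "\<tau> \<in> borel_measurable borel"
proof (rule borel_measurable_mono, rule monoI)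
  fix u v :: real assume "u \<le> v"
  then have "max 0 u = max 0 v \<or> max 0 u < max 0 v" by linarith
  then have "\<tau> (max 0 u) \<le> \<tau> (max 0 v)"
    using \<tau>_strict_mono[of "max 0 u" "max 0 v"] by (metis max.cobounded1 less_imp_le order.refl)
  then show "\<tau> u \<le> \<tau> v"
    by (metis \<tau>_max)
qed

text \<open>Immediately to the right of \<open>\<tau> u\<close> the staircase exceeds
  \<open>u\<close>, so it is constant on no open interval around that point, and perfectness of
  \<open>F\<close> applies.\<close>

lemma \<tau>_in_F: "0 \<le> u \<Longrightarrow> \<tau> u \<in> F"
proof -
  assume u: "0 \<le> u"
  have "\<not> S constant_on {a<..<b}" if ab: "a < \<tau> u" "\<tau> u < b" for a b
  proof
    assume "S constant_on {a<..<b}"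
    moreover obtain t where "\<tau> u < t" "t < b" using dense[OF ab(2)] by blast
    ultimately have "S t = S (\<tau> u)" using ab by (force simp: constant_on_def)
    with \<open>\<tau> u < t\<close> show False using u by (simp add: \<tau>_less_iff S_\<tau>)
  qed
  then have "\<tau> u \<in> points_of_change S" by (auto simp: points_of_change_def)
  with perfect show ?thesis by (simp add: alpha_perfect_def)
qed

text \<open>The reason for half-open intervals below: \<open>\<tau> (S d)\<close> may lie beyond
  \<open>d\<close>, when \<open>d\<close> is in a gap of \<open>F\<close>.\<close>

lemma \<tau>_in_Icc: "0 \<le> S c \<Longrightarrow> S c \<le> u \<Longrightarrow> u < S d \<Longrightarrow> \<tau> u \<in> F \<inter> {c..d}"
  using \<tau>_in_F[of u] \<tau>_less_iff[of u d] S_le_iff_le_\<tau>[of u c] by simp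

text \<open>Turns limits along \<open>F\<close> at \<open>\<tau> u\<close> into right limits at
  \<open>u\<close>. Strict monotonicity keeps \<open>\<tau> v\<close> above \<open>\<tau> u\<close>;
  the Galois connection keeps it below any \<open>a > \<tau> u\<close>, as soon as
  \<open>v < S a\<close>.\<close>

lemma filterlim_\<tau>:
  assumes "0 \<le> u"
  shows "filterlim \<tau> (at (\<tau> u) within F \<inter> {0..}) (at_right u)"
  unfolding filterlim_at
proof
  show "\<forall>\<^sub>F v in at_right u. \<tau> v \<in> F \<inter> {0..} \<and> \<tau> v \<noteq> \<tau> u"
    using eventually_at_right_less[of u]
  proof eventually_elim
    case (elim v)
    then show ?case using assms \<tau>_strict_mono[of u v] \<tau>_in_F[of v] \<tau>_nonneg[of v] by simp
  qed
  show "(\<tau> \<longlongrightarrow> \<tau> u) (at_right u)"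
  proof (rule order_tendstoI)
    fix a assume "a < \<tau> u"
    show "\<forall>\<^sub>F v in at_right u. a < \<tau> v"
      using eventually_at_right_less[of u]
    proof eventually_elim
      case (elim v)
      then show ?case using assms \<tau>_strict_mono[of u v] \<open>a < \<tau> u\<close> by simp
    qed
  next
    fix a assume "\<tau> u < a"
    then have "u < S a" using assms by (simp add: \<tau>_less_iff)
    then have "\<forall>\<^sub>F v in at_right u. u < v \<and> v < S a"
      using eventually_at_right[of u "S a"] by blast
    then show "\<forall>\<^sub>F v in at_right u. \<tau> v < a"
    proof eventually_elim
      case (elim v)
      then show ?case using assms by (simp add: \<tau>_less_iff)
    qed
  qed
qed

subsection \<open>Fractal integrals as Lebesgue integrals\<close>

text \<open>Extending \<open>h\<close> by zero outside \<open>A\<close> makes it Borel on the whole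
  line; the extension is invisible because \<open>\<tau>\<close> maps \<open>B\<close> into
  \<open>A\<close>.\<close>

lemma set_measurable_comp_\<tau>:
  fixes h :: "real \<Rightarrow> real"
  assumes cont: "continuous_on A h" and [measurable]: "A \<in> sets borel" "B \<in> sets borel"
    and sub: "\<And>u. u \<in> B \<Longrightarrow> \<tau> u \<in> A"
  shows "set_borel_measurable borel B (\<lambda>u. h (\<tau> u))"
proof -
  have [measurable]: "(\<lambda>t. if t \<in> A then h t else 0) \<in> borel_measurable borel"
    by (rule borel_measurable_continuous_on_if) (use cont in auto)
  have "(\<lambda>u. indicator B u *\<^sub>R (if \<tau> u \<in> A then h (\<tau> u) else 0)) \<in> borel_measurable borel"
    using measurable_compose[OF \<tau>_measurable, of "\<lambda>t. if t \<in> A then h t else 0" borel] by measurable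
  also have "(\<lambda>u. indicator B u *\<^sub>R (if \<tau> u \<in> A then h (\<tau> u) else 0)) = (\<lambda>u. indicator B u *\<^sub>R h (\<tau> u))"
    using sub by (auto simp: fun_eq_iff indicator_def)
  finally show ?thesis unfolding set_borel_measurable_def .
qed

lemma set_integrable_comp_\<tau>:
  fixes h :: "real \<Rightarrow> real"
  assumes "0 \<le> S c" and cont: "continuous_on (F \<inter> {c..d}) h"
  shows "set_integrable lborel {S c..<S d} (\<lambda>u. h (\<tau> u))"
proof -
  have "compact (F \<inter> {c..d})" using closed_F by (simp add: closed_Int_compact)
  then have "bounded (h ` (F \<inter> {c..d}))"
    using cont by (intro compact_imp_bounded compact_continuous_image)
  then obtain C where C: "\<And>t. t \<in> F \<inter> {c..d} \<Longrightarrow> \<bar>h t\<bar> \<le> C"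
    unfolding bounded_iff real_norm_def by blast
  have "set_borel_measurable borel {S c..<S d} (\<lambda>u. h (\<tau> u))"
    by (rule set_measurable_comp_\<tau>[OF cont]) (use closed_F \<tau>_in_Icc[OF assms(1)] in auto)
  then have meas: "(\<lambda>u. indicator {S c..<S d} u *\<^sub>R h (\<tau> u)) \<in> borel_measurable lborel"
    by (simp add: set_borel_measurable_def)
  show ?thesis
    unfolding set_integrable_def
  proof (rule Bochner_Integration.integrable_bound[OF _ meas])
    show "integrable lborel (\<lambda>u. indicator {S c..<S d} u * C)"
      by (cases "S c \<le> S d") (auto intro!: integrable_mult_left integrable_real_indicator)
    show "AE u in lborel. norm (indicator {S c..<S d} u *\<^sub>R h (\<tau> u)) \<le> norm (indicator {S c..<S d} u * C)"
    proof (rule AE_I2)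
      fix u
      have "\<bar>h (\<tau> u)\<bar> \<le> \<bar>C\<bar>" if "u \<in> {S c..<S d}"
        using C[OF \<tau>_in_Icc[OF assms(1)], of u] that by fastforce
      then show "norm (indicator {S c..<S d} u *\<^sub>R h (\<tau> u)) \<le> norm (indicator {S c..<S d} u * C)"
        by (auto simp: indicator_def)
    qed
  qed
qed

text \<open>Cell by cell: \<open>\<tau>\<close> sends \<open>{S (x k)..<S (x (Suc k))}\<close> into
  the points of \<open>F\<close> in the cell, so the infimum bounds \<open>h \<circ> \<tau>\<close>
  from below there, and the weight is the length of that interval.\<close>

lemma frac_lower_sum_le:
  assumes sub: "subdivision c d n x" and "0 \<le> S c"
    and cont: "continuous_on (F \<inter> {c..d}) h"
  shows "frac_lower_sum \<alpha> F h n x \<le> (LINT u:{S c..<S d}|lborel. h (\<tau> u))"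
proof -
  note Smono = monoD[OF mono_S]
  have "compact (F \<inter> {c..d})" using closed_F by (simp add: closed_Int_compact)
  then have bdd: "bdd_below (h ` (F \<inter> {c..d}))"
    using cont by (intro bounded_imp_bdd_below compact_imp_bounded compact_continuous_image)
  have int: "set_integrable lborel {S c..<S d} (\<lambda>u. h (\<tau> u))"
    by (rule set_integrable_comp_\<tau>) fact+
  have "frac_lower_sum \<alpha> F h k x \<le> (LINT u:{S c..<S (x k)}|lborel. h (\<tau> u))" if "k \<le> n" for k
    using that
  proof (induction k)
    case 0
    then show ?case using sub by (simp add: frac_lower_sum_def subdivision_def set_lebesgue_integral_def)
  next
    case (Suc k)
    have b: "c \<le> x k" "x k \<le> x (Suc k)" "x (Suc k) \<le> d"
      using subdivision_bounds[OF sub] subdivision_mono[OF sub, of k "Suc k"] Suc.prems by auto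
    then have Sb: "S c \<le> S (x k)" "S (x k) \<le> S (x (Suc k))" "S (x (Suc k)) \<le> S d"
      by (auto intro: Smono)
    let ?B = "{S (x k)..<S (x (Suc k))}" and ?X = "F \<inter> {x k..x (Suc k)}"
    have int': "set_integrable lborel ?B (\<lambda>u. h (\<tau> u))" "set_integrable lborel {S c..<S (x k)} (\<lambda>u. h (\<tau> u))"
      using Sb by (auto intro!: set_integrable_subset[OF int])
    have "(if ?X = {} then 0 else Inf (h ` ?X)) * (S (x (Suc k)) - S (x k)) \<le> (LINT u:?B|lborel. h (\<tau> u))"
    \<comment> \<open>A cell without growth of the staircase has weight 0 and an empty range of
      integration; any other cell contains points \<open>\<tau> u\<close> of \<open>F\<close>, so
      its infimum is a genuine one.\<close>
    proof (cases "S (x k) = S (x (Suc k))")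
      case True
      then show ?thesis by (simp add: set_lebesgue_integral_def)
    next
      case False
      then have X: "\<tau> u \<in> ?X" if "u \<in> ?B" for u
        using that \<tau>_in_Icc[of "x k" u "x (Suc k)"] Sb \<open>0 \<le> S c\<close> by auto
      with False Sb have "?X \<noteq> {}" by (metis atLeastLessThan_iff empty_iff order.refl order.not_eq_order_implies_strict)
      have "bdd_below (h ` ?X)" by (rule bdd_below_mono[OF bdd]) (use b in auto)
      then have le: "Inf (h ` ?X) \<le> h (\<tau> u)" if "u \<in> ?B" for u
        using X[OF that] by (intro cInf_lower) auto
      have "Inf (h ` ?X) * (S (x (Suc k)) - S (x k)) = (LINT u:?B|lborel. Inf (h ` ?X))"
        using Sb by (simp add: set_integral_const)
      also have "\<dots> \<le> (LINT u:?B|lborel. h (\<tau> u))"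
        by (rule set_integral_mono[OF _ int'(1)]) (use le Sb in \<open>auto simp: set_integrable_def\<close>)
      finally show ?thesis using \<open>?X \<noteq> {}\<close> by simp
    qed
    moreover have "(LINT u:{S c..<S (x (Suc k))}|lborel. h (\<tau> u))
       = (LINT u:{S c..<S (x k)}|lborel. h (\<tau> u)) + (LINT u:?B|lborel. h (\<tau> u))"
      using Sb int' by (subst set_integral_Un[symmetric]) (auto simp: ivl_disj_un)
    ultimately show ?case
      using Suc by (simp add: frac_lower_sum_def)
  qed
  from this[of n] show ?thesis using sub by (simp add: subdivision_def)
qed

lemma frac_upper_sum_ge:
  assumes "subdivision c d n x" and "0 \<le> S c" and "continuous_on (F \<inter> {c..d}) h"
  shows "(LINT u:{S c..<S d}|lborel. h (\<tau> u)) \<le> frac_upper_sum \<alpha> F h n x"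
proof -
  have "frac_lower_sum \<alpha> F (\<lambda>t. - h t) n x \<le> (LINT u:{S c..<S d}|lborel. - h (\<tau> u))"
    by (rule frac_lower_sum_le) (use assms in \<open>auto intro: continuous_intros\<close>)
  then show ?thesis
    using set_integral_uminus[OF set_integrable_comp_\<tau>[OF assms(2,3)]] by (simp add: frac_upper_sum_uminus)
qed

text \<open>By uniform continuity on the compact set \<open>F \<inter> {c..d}\<close>, a fine mesh
  makes the oscillation of \<open>h\<close> on each cell at most \<open>e\<close>, and the
  increments of the staircase telescope.\<close>

lemma frac_sums_close:
  assumes "c \<le> d" "0 < e" and cont: "continuous_on (F \<inter> {c..d}) h"
  shows "\<exists>n x. subdivision c d n x \<and> frac_upper_sum \<alpha> F h n x \<le> frac_lower_sum \<alpha> F h n x + e * (S d - S c)"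
proof -
  have "compact (F \<inter> {c..d})" using closed_F by (simp add: closed_Int_compact)
  then have "uniformly_continuous_on (F \<inter> {c..d}) h"
    using cont by (rule compact_uniformly_continuous[rotated])
  then obtain \<delta> where "0 < \<delta>" and \<delta>: "\<And>t t'. t \<in> F \<inter> {c..d} \<Longrightarrow> t' \<in> F \<inter> {c..d} \<Longrightarrow> \<bar>t' - t\<bar> < \<delta> \<Longrightarrow> \<bar>h t' - h t\<bar> < e"
    using \<open>0 < e\<close> unfolding uniformly_continuous_on_def dist_real_def by metis
  obtain n x where sub: "subdivision c d n x" and fine: "\<And>i. i < n \<Longrightarrow> x (Suc i) - x i < \<delta>"
    using subdivision_fine_exists[OF \<open>c \<le> d\<close> \<open>0 < \<delta>\<close>] by blast
  let ?X = "\<lambda>i. F \<inter> {x i..x (Suc i)}"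
  have "frac_upper_sum \<alpha> F h n x \<le> (\<Sum>i<n. ((if ?X i = {} then 0 else Inf (h ` ?X i)) + e) * (S (x (Suc i)) - S (x i)))"
    unfolding frac_upper_sum_def
  proof (intro sum_mono mult_right_mono)
    fix i assume "i \<in> {..<n}"
    then have i: "i < n" by simp
    show "0 \<le> S (x (Suc i)) - S (x i)"
      using monoD[OF mono_S, of "x i" "x (Suc i)"] subdivision_mono[OF sub, of i "Suc i"] i by simp
    have "Sup (h ` ?X i) \<le> Inf (h ` ?X i) + e" if ne: "?X i \<noteq> {}"
    proof (rule cSup_least)
      fix y assume "y \<in> h ` ?X i"
      then obtain t where t: "t \<in> ?X i" "y = h t" by auto
      have "y - e \<le> Inf (h ` ?X i)"
      proof (rule cInf_greatest)
        fix z assume "z \<in> h ` ?X i"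
        then obtain t' where t': "t' \<in> ?X i" "z = h t'" by auto
        have "\<bar>h t - h t'\<bar> < e"
          by (rule \<delta>) (use t t' fine[OF i] subdivision_bounds[OF sub, of i] subdivision_bounds[OF sub, of "Suc i"] i in auto)
        then show "y - e \<le> z" using t t' by simp
      qed (use ne in simp)
      then show "y \<le> Inf (h ` ?X i) + e" by simp
    qed (use ne in simp)
    then show "(if ?X i = {} then 0 else Sup (h ` ?X i)) \<le> (if ?X i = {} then 0 else Inf (h ` ?X i)) + e"
      using \<open>0 < e\<close> by auto
  qed
  also have "\<dots> = frac_lower_sum \<alpha> F h n x + e * (\<Sum>i<n. S (x (Suc i)) - S (x i))"
    by (simp add: frac_lower_sum_def distrib_right sum.distrib sum_distrib_left)
  also have "(\<Sum>i<n. S (x (Suc i)) - S (x i)) = S d - S c"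
    using sub by (simp add: sum_lessThan_telescope[of "\<lambda>i. S (x i)"] subdivision_def)
  finally show ?thesis using sub by blast
qed

text \<open>The Lebesgue integral lies between all lower and all upper sums, and some pair of sums
  is arbitrarily close, so supremum and infimum both equal it.\<close>

lemma has_frac_integral_continuous:
  assumes "0 \<le> S c" "c \<le> d" and cont: "continuous_on (F \<inter> {c..d}) h"
  shows "has_frac_integral \<alpha> F h c d (LINT u:{S c..<S d}|lborel. h (\<tau> u))"
proof -
  let ?I = "LINT u:{S c..<S d}|lborel. h (\<tau> u)"
  have ex: "\<exists>n x. subdivision c d n x"
    using subdivision_fine_exists[OF \<open>c \<le> d\<close>, of 1] by auto
  have close: "\<exists>n x. subdivision c d n x \<and> frac_upper_sum \<alpha> F h n x \<le> frac_lower_sum \<alpha> F h n x + e" if "0 < e" for e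
  proof -
    have D: "0 \<le> S d - S c" using monoD[OF mono_S \<open>c \<le> d\<close>] by simp
    \<comment> \<open>The summand 1 avoids a division by 0 when \<open>S c = S d\<close>.\<close>
    with that have "0 < e / (S d - S c + 1)" by simp
    from frac_sums_close[OF \<open>c \<le> d\<close> this cont] obtain n x where
      nx: "subdivision c d n x" "frac_upper_sum \<alpha> F h n x \<le> frac_lower_sum \<alpha> F h n x + e / (S d - S c + 1) * (S d - S c)"
      by blast
    moreover have "e / (S d - S c + 1) * (S d - S c) \<le> e"
      using D that by (simp add: field_simps)
    ultimately show ?thesis by (intro exI[of _ n] exI[of _ x]) linarith
  qed
  have "compact (F \<inter> {c..d})" using closed_F by (simp add: closed_Int_compact)
  then have bdd: "bounded (h ` (F \<inter> {c..d}))"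
    using cont by (intro compact_imp_bounded compact_continuous_image)
  have "Sup {frac_lower_sum \<alpha> F h n x | n x. subdivision c d n x} = ?I"
  proof (rule cSup_eq_non_empty)
    fix y assume y: "\<And>s. s \<in> {frac_lower_sum \<alpha> F h n x | n x. subdivision c d n x} \<Longrightarrow> s \<le> y"
    show "?I \<le> y"
    proof (rule field_le_epsilon)
      fix e :: real assume "0 < e"
      from close[OF this] obtain n x where nx: "subdivision c d n x" "frac_upper_sum \<alpha> F h n x \<le> frac_lower_sum \<alpha> F h n x + e"
        by blast
      with frac_upper_sum_ge[OF nx(1) assms(1) cont] y[of "frac_lower_sum \<alpha> F h n x"] show "?I \<le> y + e"
        by force
    qed
  qed (use ex frac_lower_sum_le[OF _ assms(1) cont] in auto)
  moreover have "Inf {frac_upper_sum \<alpha> F h n x | n x. subdivision c d n x} = ?I"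
  proof (rule cInf_eq_non_empty)
    fix y assume y: "\<And>s. s \<in> {frac_upper_sum \<alpha> F h n x | n x. subdivision c d n x} \<Longrightarrow> y \<le> s"
    show "y \<le> ?I"
    proof (rule field_le_epsilon)
      fix e :: real assume "0 < e"
      from close[OF this] obtain n x where nx: "subdivision c d n x" "frac_upper_sum \<alpha> F h n x \<le> frac_lower_sum \<alpha> F h n x + e"
        by blast
      with frac_lower_sum_le[OF nx(1) assms(1) cont] y[of "frac_upper_sum \<alpha> F h n x"] show "y \<le> ?I + e"
        by force
    qed
  qed (use ex frac_upper_sum_ge[OF _ assms(1) cont] in auto)
  ultimately show ?thesis using \<open>c \<le> d\<close> bdd unfolding has_frac_integral_def by blast
qed

lemma has_frac_integral_unique:
  "has_frac_integral \<alpha> F h c d I \<Longrightarrow> has_frac_integral \<alpha> F h c d J \<Longrightarrow> I = J"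
  unfolding has_frac_integral_def by (elim conjE) (rule trans[OF sym])

lemma frac_integral_continuous:
  assumes "0 \<le> S c" "c \<le> d" "continuous_on (F \<inter> {c..d}) h"
  shows "frac_integral \<alpha> F h c d = (LINT u:{S c..<S d}|lborel. h (\<tau> u))"
proof -
  note has = has_frac_integral_continuous[OF assms]
  then show ?thesis
    unfolding frac_integral_def by (rule the_equality) (rule has_frac_integral_unique[OF _ has])
qed

section \<open>Improper integrals in the staircase variable\<close>

text \<open>Staircase values lie strictly between \<open>p\<close> and \<open>q\<close>, so a
  continuity assumption on this set tolerates singularities at both ends.\<close>

definition region :: "ereal \<Rightarrow> ereal \<Rightarrow> real set" where
  "region p q = F \<inter> S -` einterval p q"

lemma region_iff: "t \<in> region p q \<longleftrightarrow> t \<in> F \<and> p < ereal (S t) \<and> ereal (S t) < q"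
  by (auto simp: region_def einterval_iff)

lemma region_borel [measurable]: "region p q \<in> sets borel"
proof -
  have "open (S -` einterval p q)" using cont_S by (intro open_vimage) auto
  then show ?thesis using closed_F by (auto simp: region_def)
qed

lemma \<tau>_in_region:
  assumes "0 \<le> p" "u \<in> einterval p q"
  shows "\<tau> u \<in> region p q"
proof -
  have "0 < ereal u" using assms by (auto simp only: einterval_iff intro: le_less_trans)
  then have "0 \<le> u" by simp
  with assms show ?thesis by (simp add: region_iff einterval_iff S_\<tau> \<tau>_in_F)
qed

lemma region_Icc: "p < ereal (S c) \<Longrightarrow> ereal (S d) < q \<Longrightarrow> F \<inter> {c..d} \<subseteq> region p q"
proof
  fix t assume c: "p < ereal (S c)" and d: "ereal (S d) < q" and t: "t \<in> F \<inter> {c..d}"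
  then have "ereal (S c) \<le> ereal (S t)" "ereal (S t) \<le> ereal (S d)"
    using monoD[OF mono_S] by auto
  with c d t show "t \<in> region p q"
    unfolding region_iff by (metis IntD1 less_le_trans le_less_trans)
qed

text \<open>By \<open>S (\<tau> x) = x\<close>, ends chosen in the staircase variable lift to ends
  \<open>c\<close> and \<open>d\<close> in the filters of the improper integral, whose limits can
  thus be read off along concrete sequences.\<close>

lemma filterlim_stair_ends:
  assumes "0 \<le> p" "p < q"
    and "filterlim (\<lambda>i. ereal (l i)) (at_right p) G" "filterlim (\<lambda>i. ereal (u i)) (at_left q) G"
  shows "filterlim (\<lambda>i. (\<tau> (l i), \<tau> (u i)))
    (filtercomap (\<lambda>c. ereal (S c)) (at_right p) \<times>\<^sub>F filtercomap (\<lambda>d. ereal (S d)) (at_left q)) G"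
proof -
  have [simp]: "S (\<tau> x) = x" if "p < ereal x" for x
  proof -
    have "0 < ereal x" using assms(1) that by (rule le_less_trans)
    then show ?thesis by (simp add: S_\<tau>)
  qed
  have l: "eventually (\<lambda>i. p < ereal (l i)) G"
    using assms(3) by (auto simp: filterlim_at elim: eventually_mono)
  \<comment> \<open>The identity \<open>S (\<tau> x) = x\<close> is used for
    \<open>p < ereal x\<close>; a point \<open>r\<close> between \<open>p\<close> and
    \<open>q\<close> shows that the upper ends eventually satisfy this as well.\<close>
  obtain r where "p < r" "r < q" using dense[OF \<open>p < q\<close>] by blast
  then have "eventually (\<lambda>x. r < x) (at_left q)"
    by (auto simp: eventually_at_left[OF \<open>r < q\<close>])
  then have "eventually (\<lambda>i. r < ereal (u i)) G"
    using assms(4) by (auto simp: filterlim_iff)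
  then have u: "eventually (\<lambda>i. p < ereal (u i)) G"
    by eventually_elim (use \<open>p < r\<close> in order)
  show ?thesis
    unfolding filterlim_filtercomap_iff o_def
  proof (rule filterlim_Pair; unfold filterlim_filtercomap_iff o_def)
    show "filterlim (\<lambda>x. ereal (S (\<tau> (l x)))) (at_right p) G"
      by (rule filterlim_cong[THEN iffD1, OF refl refl _ assms(3)]) (use l in \<open>auto elim: eventually_mono\<close>)
    show "filterlim (\<lambda>x. ereal (S (\<tau> (u x)))) (at_left q) G"
      by (rule filterlim_cong[THEN iffD1, OF refl refl _ assms(4)]) (use u in \<open>auto elim: eventually_mono\<close>)
  qed
qed

lemma einterval_ends_approx:
  fixes p q :: ereal
  assumes "p < q"
  obtains l u :: "nat \<Rightarrow> real" where
    "einterval p q = (\<Union>i. {l i .. u i})"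
    "incseq u" "decseq l" "\<And>i. l i < u i" "\<And>i. p < l i" "\<And>i. u i < q"
    "l \<longlonglongrightarrow> p" "u \<longlonglongrightarrow> q"
    "filterlim (\<lambda>i. ereal (l i)) (at_right p) sequentially"
    "filterlim (\<lambda>i. ereal (u i)) (at_left q) sequentially"
proof (rule einterval_Icc_approximation[OF assms])
  fix l u :: "nat \<Rightarrow> real"
  assume lu: "einterval p q = (\<Union>i. {l i .. u i})"
    "incseq u" "decseq l" "\<And>i. l i < u i" "\<And>i. p < l i" "\<And>i. u i < q"
    "l \<longlonglongrightarrow> p" "u \<longlonglongrightarrow> q"
  have "filterlim (\<lambda>i. ereal (l i)) (at_right p) sequentially"
    using less_imp_neq[OF lu(5), symmetric] lu(5,7) by (simp add: filterlim_at)
  moreover have "filterlim (\<lambda>i. ereal (u i)) (at_left q) sequentially"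
    using less_imp_neq[OF lu(6)] lu(6,8) by (simp add: filterlim_at)
  ultimately show thesis using that lu by blast
qed

text \<open>Both values are limits along one and the same sequence of ends.\<close>

lemma has_stair_integral_unique:
  assumes "0 \<le> p" "p < q"
    and "has_stair_integral \<alpha> F h p q I" "has_stair_integral \<alpha> F h p q J"
  shows "I = J"
proof -
  obtain l u :: "nat \<Rightarrow> real" where
    "filterlim (\<lambda>i. ereal (l i)) (at_right p) sequentially"
    "filterlim (\<lambda>i. ereal (u i)) (at_left q) sequentially"
    using einterval_ends_approx[OF \<open>p < q\<close>] by metis
  note * = filterlim_stair_ends[OF assms(1,2) this]
  have "(\<lambda>i. (\<lambda>(c, d). frac_integral \<alpha> F h c d) (\<tau> (l i), \<tau> (u i))) \<longlonglongrightarrow> I"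
    by (rule filterlim_compose[OF _ *]) (use assms in \<open>auto simp: has_stair_integral_def\<close>)
  moreover have "(\<lambda>i. (\<lambda>(c, d). frac_integral \<alpha> F h c d) (\<tau> (l i), \<tau> (u i))) \<longlonglongrightarrow> J"
    by (rule filterlim_compose[OF _ *]) (use assms in \<open>auto simp: has_stair_integral_def\<close>)
  ultimately show ?thesis by (rule LIMSEQ_unique)
qed

text \<open>On compact pieces the fractal integral is the Lebesgue integral over
  \<open>{S c..<S d}\<close>, and integrability makes these converge to the full integral.\<close>

lemma has_stair_integral_continuous:
  assumes "0 \<le> p" "p < q" and cont: "continuous_on (region p q) h"
    and int: "set_integrable lborel (einterval p q) (\<lambda>u. h (\<tau> u))"
  shows "has_stair_integral \<alpha> F h p q (LBINT u=p..q. h (\<tau> u))"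
proof -
  have cont': "continuous_on (F \<inter> {c..d}) h" if "p < ereal (S c)" "ereal (S d) < q" for c d
    using continuous_on_subset[OF cont region_Icc] that by blast
  have pos: "0 \<le> S c" if "p < ereal (S c)" for c
    using le_less_trans[OF \<open>0 \<le> p\<close> that] by simp
  \<comment> \<open>Separates the two ends: eventually \<open>S c < r < S d\<close>, which yields
    the \<open>c \<le> d\<close> required for the compact integral.\<close>
  obtain r where r: "p < r" "r < q" using dense[OF \<open>p < q\<close>] by blast
  let ?Fp = "filtercomap (\<lambda>c. ereal (S c)) (at_right p)" and ?Fq = "filtercomap (\<lambda>d. ereal (S d)) (at_left q)"
  have "((\<lambda>x. (\<lambda>(a, b). LINT u:{real_of_ereal a..<real_of_ereal b}|lborel. h (\<tau> u)) (ereal (S (fst x)), ereal (S (snd x)))) \<longlongrightarrow> (LBINT u=p..q. h (\<tau> u)))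
     (?Fp \<times>\<^sub>F ?Fq)"
    by (rule filterlim_compose[OF tendsto_set_integral_einterval[OF \<open>p < q\<close> int]])
       (intro filterlim_Pair filterlim_compose[OF filterlim_filtercomap filterlim_fst] filterlim_compose[OF filterlim_filtercomap filterlim_snd])
  moreover have "eventually (\<lambda>x. (\<lambda>(a, b). LINT u:{real_of_ereal a..<real_of_ereal b}|lborel. h (\<tau> u)) (ereal (S (fst x)), ereal (S (snd x)))
     = (case x of (c, d) \<Rightarrow> frac_integral \<alpha> F h c d)) (?Fp \<times>\<^sub>F ?Fq)"
    unfolding eventually_prod_filter
  proof (intro exI conjI allI impI)
    show "eventually (\<lambda>c. p < ereal (S c) \<and> ereal (S c) < r) ?Fp"
      by (rule eventually_filtercomapI[where P = "\<lambda>x. p < x \<and> x < r"])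
         (use r in \<open>auto simp: eventually_at_right[OF r(1)]\<close>)
    show "eventually (\<lambda>d. r < ereal (S d) \<and> ereal (S d) < q) ?Fq"
      by (rule eventually_filtercomapI[where P = "\<lambda>x. r < x \<and> x < q"])
         (use r in \<open>auto simp: eventually_at_left[OF r(2)]\<close>)
    fix c d assume c: "p < ereal (S c) \<and> ereal (S c) < r" and d: "r < ereal (S d) \<and> ereal (S d) < q"
    then have "ereal (S c) < ereal (S d)" by (metis less_trans)
    then have "c \<le> d" using monoD[OF mono_S, of d c] by (cases "c \<le> d") auto
    with c d show "(\<lambda>(a, b). LINT u:{real_of_ereal a..<real_of_ereal b}|lborel. h (\<tau> u)) (ereal (S (fst (c, d))), ereal (S (snd (c, d))))
     = (case (c, d) of (c, d) \<Rightarrow> frac_integral \<alpha> F h c d)"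
      using frac_integral_continuous[OF pos _ cont', of c d] by simp
  qed
  ultimately have "((\<lambda>(c, d). frac_integral \<alpha> F h c d) \<longlongrightarrow> (LBINT u=p..q. h (\<tau> u))) (?Fp \<times>\<^sub>F ?Fq)"
    by (rule Lim_transform_eventually)
  moreover have "\<exists>J. has_frac_integral \<alpha> F h c d J" if "c \<le> d" "p < ereal (S c)" "ereal (S d) < q" for c d
    using has_frac_integral_continuous[OF pos that(1) cont', of ] that by blast
  ultimately show ?thesis using \<open>p < q\<close> by (auto simp: has_stair_integral_def)
qed

lemma stair_integral_continuous:
  assumes "0 \<le> p" "p < q" "continuous_on (region p q) h"
    and "set_integrable lborel (einterval p q) (\<lambda>u. h (\<tau> u))"
  shows "stair_integral \<alpha> F h p q = (LBINT u=p..q. h (\<tau> u))"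
proof -
  note has = has_stair_integral_continuous[OF assms]
  then show ?thesis
    unfolding stair_integral_def by (rule the_equality) (rule has_stair_integral_unique[OF assms(1,2) _ has])
qed

text \<open>Integrals of \<open>\<bar>h \<circ> \<tau>\<bar>\<close> over an exhausting sequence of
  intervals converge to \<open>J\<close>; for a nonnegative function this already gives
  integrability on the union.\<close>

lemma stair_integral_abs_imp_integrable:
  assumes "0 \<le> p" "p < q" and cont: "continuous_on (region p q) h"
    and ex: "has_stair_integral \<alpha> F (\<lambda>t. \<bar>h t\<bar>) p q J"
  shows "set_integrable lborel (einterval p q) (\<lambda>u. h (\<tau> u))"
proof (rule einterval_ends_approx[OF \<open>p < q\<close>])
  fix l u :: "nat \<Rightarrow> real"
  assume lu: "einterval p q = (\<Union>i. {l i .. u i})"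
    "incseq u" "decseq l" "\<And>i. l i < u i" "\<And>i. p < l i" "\<And>i. u i < q"
    "l \<longlonglongrightarrow> p" "u \<longlonglongrightarrow> q"
    and lims: "filterlim (\<lambda>i. ereal (l i)) (at_right p) sequentially"
    "filterlim (\<lambda>i. ereal (u i)) (at_left q) sequentially"
  have pos: "0 \<le> l i" "0 \<le> u i" for i
  proof -
    have "0 < ereal (l i)" using \<open>0 \<le> p\<close> lu(5) by (rule le_less_trans)
    then show "0 \<le> l i" "0 \<le> u i" using lu(4)[of i] by simp_all
  qed
  have le: "\<tau> (l i) \<le> \<tau> (u i)" for i
    using \<tau>_strict_mono[OF pos(1) lu(4)] by (simp add: less_imp_le)
  have cont': "continuous_on (F \<inter> {\<tau> (l i)..\<tau> (u i)}) (\<lambda>t. \<bar>h t\<bar>)" for i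
    by (rule continuous_on_rabs, rule continuous_on_subset[OF cont region_Icc]) (use lu pos in \<open>simp_all add: S_\<tau>\<close>)
  have meas: "set_borel_measurable borel (einterval p q) (\<lambda>u. h (\<tau> u))"
    by (rule set_measurable_comp_\<tau>[OF cont]) (use \<tau>_in_region[OF \<open>0 \<le> p\<close>] in auto)
  have *: "set_integrable lborel {l i..<u i} (\<lambda>u. \<bar>h (\<tau> u)\<bar>)" for i
    using set_integrable_comp_\<tau>[OF _ cont'[of i]] pos by (simp add: S_\<tau>)
  \<comment> \<open>The exhaustion uses closed intervals while the fractal integrals produce
    half-open ones; they differ in one point.\<close>
  have ae: "AE x in lborel. indicator {l i..<u i} x = (indicator {l i..u i} x :: real)" for i
    using AE_lborel_singleton[of "u i"] by eventually_elim (auto simp: indicator_def)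
  have "set_integrable lborel (einterval p q) (\<lambda>u. \<bar>h (\<tau> u)\<bar>)"
  proof (rule interval_integral_Icc_approx_nonneg(1)[OF \<open>p < q\<close> lu])
    show "set_borel_measurable lborel (einterval p q) (\<lambda>x. \<bar>h (\<tau> x)\<bar>)"
    proof -
      have "(\<lambda>x. \<bar>indicator (einterval p q) x *\<^sub>R h (\<tau> x)\<bar>) \<in> borel_measurable borel"
        using meas unfolding set_borel_measurable_def by measurable
      then show ?thesis by (simp add: set_borel_measurable_def abs_mult)
    qed
    show "set_integrable lborel {l i..u i} (\<lambda>u. \<bar>h (\<tau> u)\<bar>)" for i
    proof -
      have "{l i..u i} \<in> sets borel" "{l i..u i} \<subseteq> einterval p q" using lu(1) by auto
      then have "set_borel_measurable borel {l i..u i} (\<lambda>u. h (\<tau> u))"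
        using set_borel_measurable_subset[OF meas] by simp
      then have "(\<lambda>x. \<bar>indicator {l i..u i} x *\<^sub>R h (\<tau> x)\<bar>) \<in> borel_measurable borel"
        unfolding set_borel_measurable_def by measurable
      then have m: "(\<lambda>x. indicator {l i..u i} x *\<^sub>R \<bar>h (\<tau> x)\<bar>) \<in> borel_measurable lborel"
        by (simp add: abs_mult)
      show ?thesis
        unfolding set_integrable_def
        by (rule integrable_cong_AE_imp[OF *[of i, unfolded set_integrable_def] m])
           (use ae[of i] in \<open>auto elim: eventually_mono\<close>)
    qed
    have "(\<lambda>i. (\<lambda>(c, d). frac_integral \<alpha> F (\<lambda>t. \<bar>h t\<bar>) c d) (\<tau> (l i), \<tau> (u i))) \<longlonglongrightarrow> J"
      by (rule filterlim_compose[OF _ filterlim_stair_ends[OF assms(1,2) lims]])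
         (use ex \<open>p < q\<close> in \<open>auto simp: has_stair_integral_def\<close>)
    moreover have "frac_integral \<alpha> F (\<lambda>t. \<bar>h t\<bar>) (\<tau> (l i)) (\<tau> (u i)) = (LBINT x=l i..u i. \<bar>h (\<tau> x)\<bar>)" for i
      using frac_integral_continuous[OF _ le[of i] cont'[of i]] pos[of i] lu(4)[of i]
      by (simp add: S_\<tau> interval_integral_Ico less_imp_le)
    ultimately show "(\<lambda>i. LBINT x=l i..u i. \<bar>h (\<tau> x)\<bar>) \<longlonglongrightarrow> J" by simp
  qed simp
  then show ?thesis
    using set_integrable_abs_iff[of lborel "einterval p q" "\<lambda>u. h (\<tau> u)"] meas
    by (simp add: set_borel_measurable_def)
qed

section \<open>Classical form of the Laplace transform and the gamma function\<close>

lemma region_0_infty: "region 0 \<infinity> = {t \<in> F. 0 < S t}"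
  by (auto simp: region_iff)

text \<open>Absolute convergence supplies integrability of the pulled-back integrand; conversely,
  integrability yields both the signed and the absolute improper integral.\<close>

lemma
  assumes cont: "continuous_on {t \<in> F. 0 < S t} h"
  shows frac_laplace_exists_iff:
      "frac_laplace_exists \<alpha> F h \<sigma> \<longleftrightarrow> set_integrable lborel {0<..} (\<lambda>u. exp (- \<sigma> * u) * h (\<tau> u))" (is "_ \<longleftrightarrow> ?int")
    and frac_laplace_eq: "set_integrable lborel {0<..} (\<lambda>u. exp (- \<sigma> * u) * h (\<tau> u)) \<Longrightarrow>
      frac_laplace \<alpha> F h \<sigma> = (LINT u:{0<..}|lborel. exp (- \<sigma> * u) * h (\<tau> u))"
proof -
  let ?h = "\<lambda>t. exp (- \<sigma> * S t) * h t"
  have S: "continuous_on A S" for A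
    by (rule continuous_on_subset[OF cont_S]) simp
  have cont': "continuous_on (region 0 \<infinity>) ?h"
    unfolding region_0_infty by (intro continuous_intros cont S)
  have cong: "set_integrable lborel {0<..} (\<lambda>u. ?h (\<tau> u)) \<longleftrightarrow> ?int"
    by (rule set_integrable_cong) (auto simp: S_\<tau>)
  have *: "?int" if "frac_laplace_exists \<alpha> F h \<sigma>"
    using that stair_integral_abs_imp_integrable[OF _ _ cont'] cong
    by (auto simp: frac_laplace_exists_def zero_ereal_def[symmetric])
  have "frac_laplace_exists \<alpha> F h \<sigma>" if ?int
  proof -
    have int: "set_integrable lborel (einterval 0 \<infinity>) (\<lambda>u. ?h (\<tau> u))" using that cong by simp
    have "continuous_on (region 0 \<infinity>) (\<lambda>t. \<bar>?h t\<bar>)" by (intro continuous_on_rabs cont')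
    from has_stair_integral_continuous[OF _ _ this set_integrable_abs[OF int]] has_stair_integral_continuous[OF _ _ cont' int]
    show ?thesis by (auto simp: frac_laplace_exists_def zero_ereal_def[symmetric])
  qed
  with * show "frac_laplace_exists \<alpha> F h \<sigma> \<longleftrightarrow> ?int" by blast
  assume ?int
  with cong have "stair_integral \<alpha> F ?h 0 \<infinity> = (LBINT u=0..\<infinity>. ?h (\<tau> u))"
    by (intro stair_integral_continuous cont') auto
  also have "\<dots> = (LINT u:{0<..}|lborel. ?h (\<tau> u))"
    by (simp add: interval_lebesgue_integral_def)
  also have "\<dots> = (LINT u:{0<..}|lborel. exp (- \<sigma> * u) * h (\<tau> u))"
    by (rule set_lebesgue_integral_cong) (auto simp: S_\<tau>)
  finally show "frac_laplace \<alpha> F h \<sigma> = (LINT u:{0<..}|lborel. exp (- \<sigma> * u) * h (\<tau> u))"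
    by (simp add: frac_laplace_def zero_ereal_def[symmetric])
qed

text \<open>In the staircase variable this is Euler's integral, that is, the Laplace transform of
  \<open>power_kernel \<beta>\<close> at 1.\<close>

lemma frac_Gamma_eq:
  assumes "\<beta> < 1"
  shows "frac_Gamma \<alpha> F (1 - \<beta>) = Gamma (1 - \<beta>)"
proof -
  let ?h = "\<lambda>t. exp (- S t) * S t powr (1 - \<beta> - 1)"
  have eq: "indicator {0<..} u *\<^sub>R ?h (\<tau> u) = exp (- 1 * u) * power_kernel \<beta> u" for u
    by (auto simp: indicator_def power_kernel_def S_\<tau>)
  have S: "continuous_on A S" for A
    by (rule continuous_on_subset[OF cont_S]) simp
  have "continuous_on (region 0 \<infinity>) ?h"
    unfolding region_0_infty by (intro continuous_intros S) auto
  moreover have "set_integrable lborel (einterval 0 \<infinity>) (\<lambda>u. ?h (\<tau> u))"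
    unfolding set_integrable_def einterval_0_infty eq
    using assms by (intro Laplace_power_kernel) auto
  ultimately have "stair_integral \<alpha> F ?h 0 \<infinity> = (LBINT u=0..\<infinity>. ?h (\<tau> u))"
    by (intro stair_integral_continuous) auto
  also have "\<dots> = (LINT u|lborel. exp (- 1 * u) * power_kernel \<beta> u)"
    unfolding interval_lebesgue_integral_def set_lebesgue_integral_def einterval_0_infty eq by simp
  also have "\<dots> = Gamma (1 - \<beta>)"
    using assms Laplace_power_kernel(2)[of 1 \<beta>] by simp
  finally show ?thesis by (simp add: frac_Gamma_def zero_ereal_def[symmetric])
qed

end

subsection \<open>The transform formulas\<close>

locale frac_diff_fun = frac_staircase +
  fixes f :: "real \<Rightarrow> real"
  assumes diff: "frac_differentiable \<alpha> F f"
begin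

abbreviation D :: "real \<Rightarrow> real" where "D \<equiv> frac_deriv \<alpha> F {0..} (\<lambda>t. f (S t))"

lemma at_within_local:
  fixes x :: real
  assumes "x < b"
  shows "at x within F \<inter> {0..b} = at x within F \<inter> {0..}"
  by (rule at_within_nhd[of _ "{..<b}"]) (use assms in auto)

lemma continuous_on_D: "continuous_on (F \<inter> {0..}) D"
  unfolding continuous_on_def
proof
  fix x assume x: "x \<in> F \<inter> {0..}"
  then have "continuous_on (F \<inter> {0..x+1}) D"
    using diff by (simp add: frac_differentiable_def)
  then have "(D \<longlongrightarrow> D x) (at x within F \<inter> {0..x+1})"
    using x by (auto simp: continuous_on_def)
  then show "(D \<longlongrightarrow> D x) (at x within F \<inter> {0..})"
    using at_within_local[of x "x+1"] by simp
qed

lemma has_frac_deriv_ex: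
  assumes "x \<in> F \<inter> {0..}"
  shows "\<exists>d. has_frac_deriv \<alpha> F {0..} (\<lambda>t. f (S t)) d x"
proof -
  have "0 < x + 1" "x \<in> F \<inter> {0..x+1}" using assms by auto
  then show ?thesis using diff unfolding frac_differentiable_def by blast
qed

lemma has_frac_deriv_D:
  assumes "0 \<le> u"
  shows "has_frac_deriv \<alpha> F {0..} (\<lambda>t. f (S t)) (D (\<tau> u)) (\<tau> u)"
proof -
  have mem: "\<tau> u \<in> F \<inter> {0..}" using assms \<tau>_in_F \<tau>_nonneg by simp
  then obtain d where d: "has_frac_deriv \<alpha> F {0..} (\<lambda>t. f (S t)) d (\<tau> u)"
    using has_frac_deriv_ex by blast
  \<comment> \<open>The points \<open>\<tau> v\<close> with \<open>v > u\<close> accumulate at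
    \<open>\<tau> u\<close>, so the \<open>Lim\<close> in \<open>D\<close> is a genuine, unique
    limit.\<close>
  have "at (\<tau> u) within F \<inter> {0..} \<noteq> bot"
    using filterlim_\<tau>[OF assms]
    by (metis filterlim_def bot.extremum_uniqueI filtermap_bot_iff trivial_limit_at_right_real)
  then have "D (\<tau> u) = d"
    using d mem unfolding frac_deriv_def has_frac_deriv_def by (simp add: tendsto_Lim)
  with d show ?thesis by simp
qed

text \<open>Along \<open>\<tau>\<close> the fractal difference quotient becomes the ordinary one,
  because \<open>S (\<tau> v) = v\<close>; as \<open>v\<close> decreases to \<open>u\<close>,
  \<open>\<tau> v\<close> approaches \<open>\<tau> u\<close> inside \<open>F\<close>.\<close>

lemma right_derivative:
  assumes "0 \<le> u"
  shows "(f has_real_derivative D (\<tau> u)) (at_right u)"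
proof -
  have "((\<lambda>v. (f (S (\<tau> v)) - f (S (\<tau> u))) / (S (\<tau> v) - S (\<tau> u))) \<longlongrightarrow> D (\<tau> u)) (at_right u)"
    using filterlim_compose[OF has_frac_deriv_D[OF assms, unfolded has_frac_deriv_def] filterlim_\<tau>[OF assms]] .
  moreover have "eventually (\<lambda>v. (f (S (\<tau> v)) - f (S (\<tau> u))) / (S (\<tau> v) - S (\<tau> u)) = (f v - f u) / (v - u)) (at_right u)"
    using eventually_at_right_less[of u] by eventually_elim (use assms in \<open>simp add: S_\<tau>\<close>)
  ultimately show ?thesis
    unfolding has_field_derivative_iff by (rule Lim_transform_eventually)
qed

lemma D_\<tau>_right_continuous:
  assumes "0 \<le> u"
  shows "((\<lambda>v. D (\<tau> v)) \<longlongrightarrow> D (\<tau> u)) (at_right u)"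
proof -
  have "(D \<longlongrightarrow> D (\<tau> u)) (at (\<tau> u) within F \<inter> {0..})"
    using continuous_on_D assms \<tau>_in_F \<tau>_nonneg by (simp add: continuous_on_def)
  from filterlim_compose[OF this filterlim_\<tau>[OF assms]] show ?thesis .
qed

lemma continuous_on_comp: "continuous_on (F \<inter> {0..}) (\<lambda>t. f (S t))"
  unfolding continuous_on_def
proof
  fix x assume x: "x \<in> F \<inter> {0..}"
  then obtain d where d: "((\<lambda>y. (f (S y) - f (S x)) / (S y - S x)) \<longlongrightarrow> d) (at x within F \<inter> {0..})"
    using has_frac_deriv_ex unfolding has_frac_deriv_def by blast
  have "((\<lambda>y. S y) \<longlongrightarrow> S x) (at x within F \<inter> {0..})"
    using continuous_on_subset[OF cont_S, of "F \<inter> {0..}"] x by (simp add: continuous_on_def)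
  then have "((\<lambda>y. S y - S x) \<longlongrightarrow> 0) (at x within F \<inter> {0..})"
    by (rule LIM_zero)
  from tendsto_mult[OF d this]
  have "((\<lambda>y. (f (S y) - f (S x)) / (S y - S x) * (S y - S x)) \<longlongrightarrow> 0) (at x within F \<inter> {0..})" by simp
  \<comment> \<open>When \<open>S y = S x\<close>, as for the two ends of a gap, the quotient has
    the default value 0 and both sides vanish.\<close>
  moreover have "(f (S y) - f (S x)) / (S y - S x) * (S y - S x) = f (S y) - f (S x)" for y
    by (cases "S y = S x") auto
  ultimately have "((\<lambda>y. f (S y) - f (S x)) \<longlongrightarrow> 0) (at x within F \<inter> {0..})" by simp
  then show "((\<lambda>t. f (S t)) \<longlongrightarrow> f (S x)) (at x within F \<inter> {0..})"
    by (rule LIM_zero_cancel)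
qed

text \<open>The staircase restricts to a quotient map from a compact part of \<^term>\<open>F\<close> onto an
  interval, hence continuity of the composite passes to \<^term>\<open>f\<close>.\<close>

lemma continuous_on_f: "continuous_on {0..b} f"
proof (cases "0 \<le> b")
  case True
  let ?K = "F \<inter> {0..\<tau> b}"
  have cont: "continuous_on ?K (\<lambda>t. f (S t))"
    by (rule continuous_on_subset[OF continuous_on_comp]) auto
  have K: "compact ?K" using closed_F by (simp add: closed_Int_compact)
  have "closed (f -` B \<inter> {0..b})" if "closed B" for B
  proof -
    \<comment> \<open>Each \<open>u\<close> in \<open>{0..b}\<close> has the preimage
      \<open>\<tau> u\<close> in the compact set \<open>?K\<close>, so closedness is transported by
      taking the image of a compact set.\<close>
    have "f -` B \<inter> {0..b} = S ` ((\<lambda>t. f (S t)) -` B \<inter> ?K)"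
    proof (intro equalityI subsetI)
      fix u assume u: "u \<in> f -` B \<inter> {0..b}"
      then have "\<tau> u \<in> (\<lambda>t. f (S t)) -` B \<inter> ?K"
        using True S_le_iff_le_\<tau>[of b "\<tau> u"] by (simp add: S_\<tau> \<tau>_in_F \<tau>_nonneg)
      moreover have "u = S (\<tau> u)" using u by (simp add: S_\<tau>)
      ultimately show "u \<in> S ` ((\<lambda>t. f (S t)) -` B \<inter> ?K)" by blast
    next
      fix u assume "u \<in> S ` ((\<lambda>t. f (S t)) -` B \<inter> ?K)"
      then obtain t where t: "u = S t" "f (S t) \<in> B" "0 \<le> t" "t \<le> \<tau> b" by auto
      then show "u \<in> f -` B \<inter> {0..b}"
        using True S_le_iff_le_\<tau>[of b t] monoD[OF mono_S \<open>0 \<le> t\<close>] by simp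
    qed
    moreover have "closed ((\<lambda>t. f (S t)) -` B \<inter> ?K)"
      using cont K that compact_imp_closed continuous_on_closed_vimage by blast
    then have "compact ((\<lambda>t. f (S t)) -` B \<inter> ?K)"
      using K by (metis compact_Int_closed inf.left_idem inf_commute)
    then have "closed (S ` ((\<lambda>t. f (S t)) -` B \<inter> ?K))"
      by (intro compact_imp_closed compact_continuous_image continuous_on_subset[OF cont_S]) auto
    ultimately show ?thesis by simp
  qed
  then show ?thesis by (subst continuous_on_closed_vimage) auto
qed simp

lemma continuous_f_nonneg: "continuous_on {0..} f"
  unfolding continuous_on_def
proof
  fix x :: real assume "x \<in> {0..}"
  then have "(f \<longlongrightarrow> f x) (at x within {0..x+1})"
    using continuous_on_f[of "x+1"] by (auto simp: continuous_on_def)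
  moreover have "at x within {0..x+1} = at x within {0..}"
    by (rule at_within_nhd[of _ "{..<x+1}"]) auto
  ultimately show "(f \<longlongrightarrow> f x) (at x within {0..})" by simp
qed

lemma positive_part: "{t \<in> F. 0 < S t} \<subseteq> F \<inter> {0..}"
proof
  fix t assume t: "t \<in> {t \<in> F. 0 < S t}"
  with monoD[OF mono_S, of t 0] have "0 \<le> t" by (cases "0 \<le> t") auto
  with t show "t \<in> F \<inter> {0..}" by simp
qed

lemma continuous_on_D_positive: "continuous_on {t \<in> F. 0 < S t} D"
  by (rule continuous_on_subset[OF continuous_on_D positive_part])

lemma continuous_on_comp_positive: "continuous_on {t \<in> F. 0 < S t} (\<lambda>t. f (S t))"
  by (rule continuous_on_subset[OF continuous_on_comp positive_part])

text \<open>\<open>D \<circ> \<tau>\<close> may jump, but \<open>\<tau>\<close> sends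
  \<open>{0..b}\<close> into the compact set \<open>F \<inter> {0..\<tau> b}\<close>, on which
  \<open>D\<close> is continuous.\<close>

lemma D_\<tau>_bounded: "\<exists>C. \<forall>u\<in>{0..b}. \<bar>D (\<tau> u)\<bar> \<le> C"
proof (cases "0 \<le> b")
  case True
  have "compact (F \<inter> {0..\<tau> b})" using closed_F by (simp add: closed_Int_compact)
  moreover have "continuous_on (F \<inter> {0..\<tau> b}) D"
    by (rule continuous_on_subset[OF continuous_on_D]) auto
  ultimately have "bounded (D ` (F \<inter> {0..\<tau> b}))"
    by (intro compact_imp_bounded compact_continuous_image)
  then obtain C where C: "\<And>t. t \<in> F \<inter> {0..\<tau> b} \<Longrightarrow> \<bar>D t\<bar> \<le> C"
    unfolding bounded_iff real_norm_def by blast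
  have "\<tau> u \<in> F \<inter> {0..\<tau> b}" if "u \<in> {0..b}" for u
    using that True S_le_iff_le_\<tau>[of b "\<tau> u"] by (simp add: S_\<tau> \<tau>_in_F \<tau>_nonneg)
  with C show ?thesis by blast
qed simp

lemma D_\<tau>_measurable: "set_borel_measurable borel {0<..} (\<lambda>u. D (\<tau> u))"
  by (rule set_measurable_comp_\<tau>[OF continuous_on_D_positive]) 
     (use closed_F region_borel[of 0 \<infinity>] in \<open>auto simp: region_0_infty S_\<tau> \<tau>_in_F\<close>)

lemma f_measurable: "set_borel_measurable borel {0<..} f"
  by (rule set_measurable_continuous_on) (auto intro: continuous_on_subset[OF continuous_f_nonneg])

section \<open>Laplace transform of the right derivative\<close>

context
  fixes \<sigma> :: real
  assumes \<sigma>: "0 < \<sigma>"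
    and f_int: "set_integrable lborel {0<..} (\<lambda>u. exp (- \<sigma> * u) * f u)"
    and D_int: "set_integrable lborel {0<..} (\<lambda>u. exp (- \<sigma> * u) * D (\<tau> u))"
begin

text \<open>\<open>p\<close> is the right derivative of \<open>P\<close>, so its integral over
  \<open>{0..b}\<close> is \<open>P b - f 0\<close>. Integrability of \<open>p\<close> makes
  \<open>P\<close> converge at infinity, and integrability of \<open>P\<close> forces that limit to
  be 0.\<close>

lemma Laplace_derivative:
  "(LINT u:{0<..}|lborel. exp (- \<sigma> * u) * D (\<tau> u)) = \<sigma> * (LINT u:{0<..}|lborel. exp (- \<sigma> * u) * f u) - f 0"
proof -
  define P where "P = (\<lambda>u. exp (- \<sigma> * u) * f u)"
  define p where "p = (\<lambda>u. exp (- \<sigma> * u) * D (\<tau> u) - \<sigma> * (exp (- \<sigma> * u) * f u))"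
  have p_int: "set_integrable lborel {0<..} p"
    unfolding p_def by (intro set_integral_diff D_int set_integrable_mult_right f_int)
  \<comment> \<open>The point 0 is added as a null set, so that the compact integrals start at 0,
    where the boundary value \<open>f 0\<close> arises.\<close>
  then have p_int0: "set_integrable lborel {0..} p"
    by (subst set_integrable_discrete_difference[where X = "{0}" and B = "{0<..}"]) auto
  have p_eq0: "(LINT u:{0..}|lborel. p u) = (LINT u:{0<..}|lborel. p u)"
    by (rule set_integral_discrete_difference[where X = "{0}"]) auto
  have FTC: "(LINT u:{0..b}|lborel. p u) = P b - f 0" if "0 \<le> b" for b
  proof -
    have "set_integrable lborel {0..b} p"
      by (rule set_integrable_subset[OF p_int0]) auto
    note * = set_borel_integral_eq_integral[OF this]
    have "integral {0..b} p = P b - P 0"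
    proof (rule right_derivative_FTC[OF \<open>0 \<le> b\<close>])
      show "continuous_on {0..b} P"
        unfolding P_def by (intro continuous_intros continuous_on_f)
      show "p integrable_on {0..b}"
        by (rule *(1))
      fix x assume x: "0 \<le> x" "x < b"
      show "(P has_real_derivative p x) (at_right x)"
        unfolding P_def p_def
        by (auto intro!: derivative_eq_intros right_derivative x simp: algebra_simps)
      have "(f \<longlongrightarrow> f x) (at_right x)"
        using continuous_f_nonneg x
        by (auto simp: continuous_on_def intro: tendsto_within_subset)
      then show "(p \<longlongrightarrow> p x) (at_right x)"
        unfolding p_def using x by (intro tendsto_intros D_\<tau>_right_continuous)
    qed
    then show ?thesis
      using *(2) by (simp add: P_def)
  qed
  have "((\<lambda>b. LINT u:{0..b}|lborel. p u) \<longlongrightarrow> (LINT u:{0<..}|lborel. p u)) at_top"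
    unfolding p_eq0[symmetric] by (rule tendsto_set_lebesgue_integral_at_top[OF _ p_int0]) simp
  moreover have "eventually (\<lambda>b. (LINT u:{0..b}|lborel. p u) = P b - f 0) at_top"
    using eventually_ge_at_top[of 0] by eventually_elim (rule FTC)
  ultimately have "((\<lambda>b. P b - f 0) \<longlongrightarrow> (LINT u:{0<..}|lborel. p u)) at_top"
    by (rule Lim_transform_eventually)
  from tendsto_add[OF this tendsto_const[of "f 0"]]
  have "(P \<longlongrightarrow> (LINT u:{0<..}|lborel. p u) + f 0) at_top" by simp
  then have "(LINT u:{0<..}|lborel. p u) + f 0 = 0"
    using f_int unfolding P_def by (intro integrable_tendsto_at_top_imp_zero)
  moreover have "(LINT u:{0<..}|lborel. p u) = (LINT u:{0<..}|lborel. exp (- \<sigma> * u) * D (\<tau> u)) - \<sigma> * (LINT u:{0<..}|lborel. exp (- \<sigma> * u) * f u)"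
    unfolding p_def using D_int f_int
    by (subst set_integral_diff(2)) (auto simp del: exp_minus)
  ultimately show ?thesis by simp
qed

section \<open>Laplace transform of the combined derivative\<close>

context
  fixes \<beta> :: real and L1 L2 :: "real \<Rightarrow> real"
  assumes \<beta>: "0 < \<beta>" "\<beta> < 1"
begin

text \<open>The integrand of the combined derivative in the staircase variable, without its kernel;
  the cutoff at 0 turns the fractional integral into a convolution on the whole line.\<close>

definition W :: "real \<Rightarrow> real" where
  "W s = indicator {0<..} s * (L1 \<beta> * f s + L2 \<beta> * D (\<tau> s))"

text \<open>\<open>Gamma (1 - \<beta>)\<close> times the classical Riemann-Liouville integral of
  order \<open>1 - \<beta>\<close> of \<open>W\<close>.\<close>

definition fractional_integral :: "real \<Rightarrow> real" where
  "fractional_integral q = (LINT s|lborel. W s * power_kernel \<beta> (q - s))"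

lemma W_measurable: "W \<in> borel_measurable borel"
proof -
  have "(\<lambda>s. L1 \<beta> * (indicator {0<..} s *\<^sub>R f s) + L2 \<beta> * (indicator {0<..} s *\<^sub>R D (\<tau> s))) \<in> borel_measurable borel"
    using f_measurable D_\<tau>_measurable unfolding set_borel_measurable_def by measurable
  also have "(\<lambda>s. L1 \<beta> * (indicator {0<..} s *\<^sub>R f s) + L2 \<beta> * (indicator {0<..} s *\<^sub>R D (\<tau> s))) = W"
    by (auto simp: W_def fun_eq_iff algebra_simps)
  finally show ?thesis .
qed

lemma W_nonpos: "s \<le> 0 \<Longrightarrow> W s = 0"
  by (simp add: W_def)

lemma W_bounded: "\<exists>C. \<forall>s\<le>b. \<bar>W s\<bar> \<le> C"
proof -
  have "bounded (f ` {0..b})"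
    using continuous_on_f by (intro compact_imp_bounded compact_continuous_image) auto
  then obtain A where A: "\<And>u. u \<in> {0..b} \<Longrightarrow> \<bar>f u\<bar> \<le> A"
    unfolding bounded_iff real_norm_def by blast
  obtain B where B: "\<And>u. u \<in> {0..b} \<Longrightarrow> \<bar>D (\<tau> u)\<bar> \<le> B"
    using D_\<tau>_bounded by blast
  have "\<bar>W s\<bar> \<le> \<bar>L1 \<beta>\<bar> * \<bar>A\<bar> + \<bar>L2 \<beta>\<bar> * \<bar>B\<bar>" if "s \<le> b" for s
  proof (cases "0 < s")
    case True
    then have "\<bar>f s\<bar> \<le> \<bar>A\<bar>" "\<bar>D (\<tau> s)\<bar> \<le> \<bar>B\<bar>"
      using A[of s] B[of s] that by auto
    then have "\<bar>L1 \<beta> * f s\<bar> + \<bar>L2 \<beta> * D (\<tau> s)\<bar> \<le> \<bar>L1 \<beta>\<bar> * \<bar>A\<bar> + \<bar>L2 \<beta>\<bar> * \<bar>B\<bar>"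
      unfolding abs_mult by (intro add_mono mult_left_mono) auto
    with True show ?thesis
      using abs_triangle_ineq[of "L1 \<beta> * f s" "L2 \<beta> * D (\<tau> s)"] by (simp add: W_def)
  qed (simp add: W_nonpos)
  then show ?thesis by blast
qed

text \<open>Both the improper integral and the normalising gamma factor become classical. The
  singularity at the upper end is integrable, because \<open>W\<close> is bounded up to
  \<open>S t\<close> and \<open>\<beta> < 1\<close>.\<close>

lemma rlc_deriv_eq:
  assumes "0 < S t"
  shows "rlc_deriv \<alpha> F L1 L2 \<beta> f t = fractional_integral (S t) / Gamma (1 - \<beta>)"
proof -
  define q where "q = S t"
  have q: "0 < q" using assms by (simp add: q_def)
  let ?h = "\<lambda>y. (L1 \<beta> * f (S y) + L2 \<beta> * D y) * (q - S y) powr (- \<beta>)"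
  have S: "continuous_on A S" for A
    by (rule continuous_on_subset[OF cont_S]) simp
  have sub: "region 0 (ereal q) \<subseteq> {t \<in> F. 0 < S t}"
    by (auto simp: region_iff)
  have "continuous_on (region 0 (ereal q)) ?h"
    by (intro continuous_intros S continuous_on_subset[OF continuous_on_D_positive sub] continuous_on_subset[OF continuous_on_comp_positive sub])
       (auto simp: region_iff)
  moreover have e: "einterval 0 (ereal q) = {0<..<q}"
    by (simp add: zero_ereal_def)
  have eq: "indicator {0<..<q} u *\<^sub>R ?h (\<tau> u) = W u * power_kernel \<beta> (q - u)" for u
    by (auto simp: indicator_def W_def power_kernel_def S_\<tau>)
  obtain C where C: "\<And>s. s \<le> q \<Longrightarrow> \<bar>W s\<bar> \<le> C" using W_bounded[of q] by blast
  have "set_integrable lborel (einterval 0 (ereal q)) (\<lambda>u. ?h (\<tau> u))"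
    unfolding set_integrable_def e eq
    by (rule fractional_integral_Hoelder(1)[OF \<beta> q order.refl W_measurable W_nonpos C])
  ultimately have "stair_integral \<alpha> F ?h 0 (ereal q) = (LBINT u=0..ereal q. ?h (\<tau> u))"
    using q by (intro stair_integral_continuous) auto
  also have "\<dots> = fractional_integral q"
    unfolding interval_lebesgue_integral_def set_lebesgue_integral_def e eq fractional_integral_def using q by simp
  finally show ?thesis
    using frac_Gamma_eq[OF \<beta>(2)] by (simp add: rlc_deriv_def q_def zero_ereal_def[symmetric])
qed

text \<open>The weight \<open>exp (- \<sigma> * q)\<close> splits into
  \<open>exp (- \<sigma> * s)\<close> and \<open>exp (- \<sigma> * (q - s))\<close>, so the integral
  of the convolution is a product of two Laplace transforms; that of \<open>D \<circ> \<tau>\<close>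
  is then expressed by that of \<open>f\<close>.\<close>

lemma Laplace_fractional_integral:
  shows "set_integrable lborel {0<..} (\<lambda>q. exp (- \<sigma> * q) * fractional_integral q)"
    and "(LINT q:{0<..}|lborel. exp (- \<sigma> * q) * fractional_integral q) =
      ((L1 \<beta> + L2 \<beta> * \<sigma>) * (LINT u:{0<..}|lborel. exp (- \<sigma> * u) * f u) - L2 \<beta> * f 0) * (Gamma (1 - \<beta>) * \<sigma> powr (\<beta> - 1))"
proof -
  define K where "K = (\<lambda>s. exp (- \<sigma> * s) * W s)"
  define M where "M = (\<lambda>r. exp (- \<sigma> * r) * power_kernel \<beta> r)"
  define w where "w = (\<lambda>u. L1 \<beta> * (exp (- \<sigma> * u) * f u) + L2 \<beta> * (exp (- \<sigma> * u) * D (\<tau> u)))"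
  have K: "indicator {0<..} s *\<^sub>R w s = K s" for s
    by (simp add: K_def w_def W_def algebra_simps)
  have "set_integrable lborel {0<..} w"
    unfolding w_def by (intro set_integral_add set_integrable_mult_right f_int D_int)
  then have K_int: "integrable lborel K"
    unfolding set_integrable_def K .
  have "(LINT s|lborel. K s) = (LINT u:{0<..}|lborel. w u)"
    unfolding set_lebesgue_integral_def K ..
  also have "\<dots> = L1 \<beta> * (LINT u:{0<..}|lborel. exp (- \<sigma> * u) * f u) + L2 \<beta> * (LINT u:{0<..}|lborel. exp (- \<sigma> * u) * D (\<tau> u))"
    unfolding w_def
    by (subst set_integral_add(2)) (intro set_integrable_mult_right f_int D_int | simp only: set_integral_mult_right)+
  also have "\<dots> = (L1 \<beta> + L2 \<beta> * \<sigma>) * (LINT u:{0<..}|lborel. exp (- \<sigma> * u) * f u) - L2 \<beta> * f 0"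
    unfolding Laplace_derivative by (simp add: algebra_simps)
  finally have K_val: "(LINT s|lborel. K s) = (L1 \<beta> + L2 \<beta> * \<sigma>) * (LINT u:{0<..}|lborel. exp (- \<sigma> * u) * f u) - L2 \<beta> * f 0" .
  have M: "integrable lborel M" "(LINT r|lborel. M r) = Gamma (1 - \<beta>) * \<sigma> powr (\<beta> - 1)"
    unfolding M_def using Laplace_power_kernel[OF \<sigma> \<beta>(2)] by blast+
  have KM: "K s * M (q - s) = exp (- \<sigma> * q) * (W s * power_kernel \<beta> (q - s))" for s q
  proof -
    have "exp (- \<sigma> * q) = exp (- \<sigma> * s) * exp (- \<sigma> * (q - s))"
      by (simp add: exp_add[symmetric] algebra_simps)
    then show ?thesis by (simp only: K_def M_def mult_ac)
  qed
  have conv: "(LINT s|lborel. K s * M (q - s)) = indicator {0<..} q *\<^sub>R (exp (- \<sigma> * q) * fractional_integral q)" for q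
  proof (cases "0 < q")
    case True
    then show ?thesis unfolding KM fractional_integral_def by simp
  next
    \<comment> \<open>For \<open>q \<le> 0\<close> every \<open>s\<close> is annihilated, either by
      \<open>W\<close> or by the kernel, so the convolution lives on \<open>{0<..}\<close>, the
      range of the transform.\<close>
    case False
    then have zero: "W s * power_kernel \<beta> (q - s) = 0" for s
      by (cases "0 < s") (auto simp: W_nonpos power_kernel_def)
    show ?thesis unfolding KM zero using False by simp
  qed
  note * = convolution_lborel[OF K_int M(1)]
  show "set_integrable lborel {0<..} (\<lambda>q. exp (- \<sigma> * q) * fractional_integral q)"
    using *(1) unfolding conv set_integrable_def .
  show "(LINT q:{0<..}|lborel. exp (- \<sigma> * q) * fractional_integral q) =
      ((L1 \<beta> + L2 \<beta> * \<sigma>) * (LINT u:{0<..}|lborel. exp (- \<sigma> * u) * f u) - L2 \<beta> * f 0) * (Gamma (1 - \<beta>) * \<sigma> powr (\<beta> - 1))"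
    using *(2) unfolding conv set_lebesgue_integral_def K_val[unfolded set_lebesgue_integral_def] M(2) .
qed

text \<open>\<open>Gamma (1 - \<beta>)\<close> cancels against the normalising factor, and
  \<open>\<sigma> powr (\<beta> - 1) = \<sigma> powr \<beta> / \<sigma>\<close> brings the result
  into shape. Existence combines integrability of the weighted convolution with continuity of the
  fractional integral.\<close>

lemma Laplace_rlc_deriv:
  shows "frac_laplace_exists \<alpha> F (rlc_deriv \<alpha> F L1 L2 \<beta> f) \<sigma>"
    and "frac_laplace \<alpha> F (rlc_deriv \<alpha> F L1 L2 \<beta> f) \<sigma> =
      (L1 \<beta> / \<sigma> + L2 \<beta>) * \<sigma> powr \<beta> * (LINT u:{0<..}|lborel. exp (- \<sigma> * u) * f u) - L2 \<beta> * \<sigma> powr (\<beta> - 1) * f 0"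
proof -
  let ?r = "rlc_deriv \<alpha> F L1 L2 \<beta> f"
  have "continuous_on {0<..} fractional_integral"
    unfolding fractional_integral_def
    by (rule fractional_integral_continuous[OF \<beta> W_measurable W_nonpos W_bounded])
  then have "continuous_on {t \<in> F. 0 < S t} (\<lambda>t. fractional_integral (S t))"
    by (rule continuous_on_compose2) (auto intro: continuous_on_subset[OF cont_S])
  then have "continuous_on {t \<in> F. 0 < S t} (\<lambda>t. fractional_integral (S t) / Gamma (1 - \<beta>))"
    using \<beta> by (intro continuous_intros) (auto simp: Gamma_eq_zero_iff)
  then have cont: "continuous_on {t \<in> F. 0 < S t} ?r"
    by (rule continuous_on_cong[THEN iffD1, rotated 2]) (auto simp: rlc_deriv_eq)
  have r: "exp (- \<sigma> * u) * ?r (\<tau> u) = exp (- \<sigma> * u) * fractional_integral u / Gamma (1 - \<beta>)" if "u \<in> {0<..}" for u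
    using that by (simp add: rlc_deriv_eq S_\<tau>)
  have int: "set_integrable lborel {0<..} (\<lambda>u. exp (- \<sigma> * u) * ?r (\<tau> u))"
    by (subst set_integrable_cong[OF refl refl r]) (auto intro!: set_integrable_divide Laplace_fractional_integral(1)[simplified])
  then show "frac_laplace_exists \<alpha> F ?r \<sigma>"
    unfolding frac_laplace_exists_iff[OF cont] .
  have "frac_laplace \<alpha> F ?r \<sigma> = (LINT u:{0<..}|lborel. exp (- \<sigma> * u) * ?r (\<tau> u))"
    by (rule frac_laplace_eq[OF cont int])
  also have "\<dots> = (LINT u:{0<..}|lborel. exp (- \<sigma> * u) * fractional_integral u / Gamma (1 - \<beta>))"
    by (rule set_lebesgue_integral_cong) (use r in auto)
  also have "\<dots> = (LINT u:{0<..}|lborel. exp (- \<sigma> * u) * fractional_integral u) / Gamma (1 - \<beta>)"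
    by (rule set_integral_divide_zero)
  also have "\<dots> = ((L1 \<beta> + L2 \<beta> * \<sigma>) * (LINT u:{0<..}|lborel. exp (- \<sigma> * u) * f u) - L2 \<beta> * f 0) * \<sigma> powr (\<beta> - 1)"
  proof -
    have "0 < Gamma (1 - \<beta>)" by (rule Gamma_real_pos) (use \<beta> in simp)
    then show ?thesis unfolding Laplace_fractional_integral(2) by simp
  qed
  also have "\<dots> = (L1 \<beta> / \<sigma> + L2 \<beta>) * \<sigma> powr \<beta> * (LINT u:{0<..}|lborel. exp (- \<sigma> * u) * f u) - L2 \<beta> * \<sigma> powr (\<beta> - 1) * f 0"
  proof -
    have "\<sigma> powr (\<beta> - 1) = \<sigma> powr \<beta> / \<sigma>" using \<sigma> by (simp add: powr_diff)
    then show ?thesis using \<sigma> by (simp only:) (simp add: field_simps)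
  qed
  finally show "frac_laplace \<alpha> F ?r \<sigma> =
      (L1 \<beta> / \<sigma> + L2 \<beta>) * \<sigma> powr \<beta> * (LINT u:{0<..}|lborel. exp (- \<sigma> * u) * f u) - L2 \<beta> * \<sigma> powr (\<beta> - 1) * f 0" .
qed

end

end

text \<open>Translates the existence of the two fractal transforms into Lebesgue integrability, with
  \<open>f (S (\<tau> u)) = f u\<close> identifying the transform of \<open>f\<close> as a classical
  one.\<close>

lemma frac_laplace_rlc_deriv:
  assumes "0 < \<beta>" "\<beta> < 1" "0 < \<sigma>"
    and f_ex: "frac_laplace_exists \<alpha> F (\<lambda>t. f (S t)) \<sigma>"
    and D_ex: "frac_laplace_exists \<alpha> F D \<sigma>"
  shows "frac_laplace_exists \<alpha> F (rlc_deriv \<alpha> F L1 L2 \<beta> f) \<sigma>"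
    and "frac_laplace \<alpha> F (rlc_deriv \<alpha> F L1 L2 \<beta> f) \<sigma> =
      (L1 \<beta> / \<sigma> + L2 \<beta>) * \<sigma> powr \<beta> * frac_laplace \<alpha> F (\<lambda>t. f (S t)) \<sigma> - L2 \<beta> * \<sigma> powr (\<beta> - 1) * f 0"
proof -
  have int: "set_integrable lborel {0<..} (\<lambda>u. exp (- \<sigma> * u) * f (S (\<tau> u)))"
    using f_ex unfolding frac_laplace_exists_iff[OF continuous_on_comp_positive] .
  then have f_int: "set_integrable lborel {0<..} (\<lambda>u. exp (- \<sigma> * u) * f u)"
    by (rule set_integrable_cong[THEN iffD1, rotated 3]) (auto simp: S_\<tau>)
  have D_int: "set_integrable lborel {0<..} (\<lambda>u. exp (- \<sigma> * u) * D (\<tau> u))"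
    using D_ex unfolding frac_laplace_exists_iff[OF continuous_on_D_positive] .
  have "frac_laplace \<alpha> F (\<lambda>t. f (S t)) \<sigma> = (LINT u:{0<..}|lborel. exp (- \<sigma> * u) * f (S (\<tau> u)))"
    by (rule frac_laplace_eq[OF continuous_on_comp_positive int])
  also have "\<dots> = (LINT u:{0<..}|lborel. exp (- \<sigma> * u) * f u)"
    by (rule set_lebesgue_integral_cong) (auto simp: S_\<tau>)
  finally have f_eq: "frac_laplace \<alpha> F (\<lambda>t. f (S t)) \<sigma> = (LINT u:{0<..}|lborel. exp (- \<sigma> * u) * f u)" .
  show "frac_laplace_exists \<alpha> F (rlc_deriv \<alpha> F L1 L2 \<beta> f) \<sigma>"
    by (rule Laplace_rlc_deriv(1)[OF assms(3) f_int D_int assms(1,2)])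
  show "frac_laplace \<alpha> F (rlc_deriv \<alpha> F L1 L2 \<beta> f) \<sigma> =
      (L1 \<beta> / \<sigma> + L2 \<beta>) * \<sigma> powr \<beta> * frac_laplace \<alpha> F (\<lambda>t. f (S t)) \<sigma> - L2 \<beta> * \<sigma> powr (\<beta> - 1) * f 0"
    unfolding f_eq by (rule Laplace_rlc_deriv(2)[OF assms(3) f_int D_int assms(1,2)])
qed

text \<open>The Laplace formula at \<open>1 / \<sigma>\<close>, multiplied by
  \<open>1 / \<sigma>\<close>; the powers of \<open>1 / \<sigma>\<close> turn into divisions by
  \<open>\<sigma> powr \<beta>\<close>.\<close>

lemma frac_sumudu_rlc_deriv:
  assumes "0 < \<beta>" "\<beta> < 1" "0 < \<sigma>"
    and f_ex: "frac_sumudu_exists \<alpha> F (\<lambda>t. f (S t)) \<sigma>"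
    and D_ex: "frac_sumudu_exists \<alpha> F D \<sigma>"
  shows "frac_sumudu_exists \<alpha> F (rlc_deriv \<alpha> F L1 L2 \<beta> f) \<sigma>"
    and "frac_sumudu \<alpha> F (rlc_deriv \<alpha> F L1 L2 \<beta> f) \<sigma> =
      (\<sigma> * L1 \<beta> + L2 \<beta>) / \<sigma> powr \<beta> * frac_sumudu \<alpha> F (\<lambda>t. f (S t)) \<sigma> - L2 \<beta> / \<sigma> powr \<beta> * f 0"
proof -
  have "0 < 1 / \<sigma>" using assms by simp
  note * = frac_laplace_rlc_deriv[OF assms(1,2) this f_ex[unfolded frac_sumudu_exists_def] D_ex[unfolded frac_sumudu_exists_def]]
  show "frac_sumudu_exists \<alpha> F (rlc_deriv \<alpha> F L1 L2 \<beta> f) \<sigma>"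
    unfolding frac_sumudu_exists_def by (rule *(1))
  have powr: "(1 / \<sigma>) powr \<beta> = 1 / \<sigma> powr \<beta>" "(1 / \<sigma>) powr (\<beta> - 1) = \<sigma> / \<sigma> powr \<beta>"
    using \<open>0 < \<sigma>\<close> by (simp_all add: powr_divide powr_diff)
  show "frac_sumudu \<alpha> F (rlc_deriv \<alpha> F L1 L2 \<beta> f) \<sigma> =
      (\<sigma> * L1 \<beta> + L2 \<beta>) / \<sigma> powr \<beta> * frac_sumudu \<alpha> F (\<lambda>t. f (S t)) \<sigma> - L2 \<beta> / \<sigma> powr \<beta> * f 0"
    unfolding frac_sumudu_def *(2) powr using \<open>0 < \<sigma>\<close> by (simp add: field_simps)
qed

end

theorem theorem3p2:
  fixes \<alpha> \<beta> :: real and F :: "real set" and L1 L2 f :: "real \<Rightarrow> real"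
  assumes "0 < \<alpha>" and "\<alpha> \<le> 1"
    and "closed F"
    and "finite_staircase \<alpha> F"
    and "continuous_on UNIV (staircase \<alpha> F)"
    and "mono (staircase \<alpha> F)"
    and "filterlim (staircase \<alpha> F) at_top at_top"
    and "alpha_perfect \<alpha> F"
    and "0 < \<beta>" and "\<beta> < 1"
    and "frac_differentiable \<alpha> F f"
  shows
    "(\<forall>v. staircase \<alpha> F v > 0
        \<and> frac_laplace_exists \<alpha> F (\<lambda>t. f (staircase \<alpha> F t)) (staircase \<alpha> F v)
        \<and> frac_laplace_exists \<alpha> F (frac_deriv \<alpha> F {0..} (\<lambda>t. f (staircase \<alpha> F t))) (staircase \<alpha> F v)
        \<longrightarrow>
        frac_laplace_exists \<alpha> F (rlc_deriv \<alpha> F L1 L2 \<beta> f) (staircase \<alpha> F v)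
        \<and> frac_laplace \<alpha> F (rlc_deriv \<alpha> F L1 L2 \<beta> f) (staircase \<alpha> F v)
          = (L1 \<beta> / staircase \<alpha> F v + L2 \<beta>) * staircase \<alpha> F v powr \<beta>
              * frac_laplace \<alpha> F (\<lambda>t. f (staircase \<alpha> F t)) (staircase \<alpha> F v)
            - L2 \<beta> * staircase \<alpha> F v powr (\<beta> - 1) * f 0)
     \<and>
     (\<forall>v. staircase \<alpha> F v > 0
        \<and> frac_sumudu_exists \<alpha> F (\<lambda>t. f (staircase \<alpha> F t)) (staircase \<alpha> F v)
        \<and> frac_sumudu_exists \<alpha> F (frac_deriv \<alpha> F {0..} (\<lambda>t. f (staircase \<alpha> F t))) (staircase \<alpha> F v)
        \<longrightarrow>
        frac_sumudu_exists \<alpha> F (rlc_deriv \<alpha> F L1 L2 \<beta> f) (staircase \<alpha> F v)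
        \<and> frac_sumudu \<alpha> F (rlc_deriv \<alpha> F L1 L2 \<beta> f) (staircase \<alpha> F v)
          = (staircase \<alpha> F v * L1 \<beta> + L2 \<beta>) / staircase \<alpha> F v powr \<beta>
              * frac_sumudu \<alpha> F (\<lambda>t. f (staircase \<alpha> F t)) (staircase \<alpha> F v)
            - L2 \<beta> / staircase \<alpha> F v powr \<beta> * f 0)"
proof -
  interpret frac_diff_fun \<alpha> F f
    by unfold_locales fact+
  show ?thesis
    using frac_laplace_rlc_deriv[OF \<open>0 < \<beta>\<close> \<open>\<beta> < 1\<close>] frac_sumudu_rlc_deriv[OF \<open>0 < \<beta>\<close> \<open>\<beta> < 1\<close>]
    by (intro conjI allI impI) (elim conjE; blast)+
qed

end
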